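(* Let $\alpha\in\mathbb{R}$, $\beta\in(0,2\pi)$ and $g\in L_1(\mathbb{R};e^{(\beta-\pi)|\tau|}d\tau)$. Then the function $$\Psi_\alpha(r,\theta)=\int_{-\infty}^\infty e^{\theta\tau}\left|K_{\alpha+i\tau}(\sqrt r)\right|^2g(\tau)\,d\tau$$ satisfies, on the wedge $\{(r,\theta):r>0,\ 0\le\theta<\beta\}$, the partial differential equation $$r^3\frac{\partial^4u}{\partial r^4}+r\frac{\partial^4u}{\partial r^2\partial\theta^2}+6r^2\frac{\partial^3u}{\partial r^3}+\frac{\partial^3u}{\partial r\,\partial\theta^2}+r(7-\alpha^2-r)\frac{\partial^2u}{\partial r^2}+\frac{\alpha^2}{r}\frac{\partial^2u}{\partial\theta^2}+\left(1-\alpha^2-\frac52r\right)\frac{\partial u}{\partial r}+\frac u2=0$$ (with $u=\Psi_\alpha$), and vanishes at infinity: $\lim_{r\to\infty}\Psi_\alpha(r,\theta)=0$.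
   Context: $K_\mu$ is the modified Bessel function of the second kind (Macdonald function). $L_1(\mathbb{R};w(\tau)d\tau)$ is the weighted space of functions $g$ with $\int_{-\infty}^\infty|g(\tau)|w(\tau)d\tau<\infty$. $(r,\theta)$ are polar coordinates in the plane.
   Formalization: The printed equation is false (e.g. for g = exp(-τ²), for every α): the signs of the terms (α²/r)∂²u/∂θ² and u/2 are corrected from plus to minus; everything else is as stated. *)

theory Defs
  imports "HOL-Analysis.Analysis"
begin

text \<open>
  The modified Bessel function of the second kind \<open>K\<^sub>\<mu>(x)\<close> of complex order, through Macdonald's
  integral \<open>\<integral>\<^sub>0\<^sup>\<infinity> e\<^bsup>-x cosh t\<^esup> cosh(\<mu>t) dt\<close>. It converges absolutely for \<open>x > 0\<close>; the values
  for \<open>x \<le> 0\<close> are meaningless.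
\<close>

definition Macdonald_K :: "complex \<Rightarrow> real \<Rightarrow> complex" where
  "Macdonald_K \<mu> x = (LINT t:{0..}|lebesgue. exp (- x * cosh t) *\<^sub>R cosh (\<mu> * of_real t))"

text \<open>Functions rather than classes modulo null sets.\<close>

definition weighted_L1 :: "(real \<Rightarrow> real) \<Rightarrow> (real \<Rightarrow> complex) set" where
  "weighted_L1 w = {g. g \<in> borel_measurable lebesgue \<and> integrable lebesgue (\<lambda>\<tau>. norm (g \<tau>) * w \<tau>)}"

definition Psi_integrand :: "real \<Rightarrow> (real \<Rightarrow> complex) \<Rightarrow> real \<Rightarrow> real \<Rightarrow> real \<Rightarrow> complex" where
  "Psi_integrand \<alpha> g r \<theta> \<tau> =
     (exp (\<theta> * \<tau>) * (norm (Macdonald_K (Complex \<alpha> \<tau>) (sqrt r)))\<^sup>2) *\<^sub>R g \<tau>"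

definition Psi :: "real \<Rightarrow> (real \<Rightarrow> complex) \<Rightarrow> real \<Rightarrow> real \<Rightarrow> complex" where
  "Psi \<alpha> g r \<theta> = (LINT \<tau>|lebesgue. Psi_integrand \<alpha> g r \<theta> \<tau>)"

text \<open>
  Classical solutions on the wedge \<open>r > 0\<close>, \<open>0 \<le> \<theta> < \<beta>\<close>: all partial derivatives occurring in
  the equation exist, and the equation holds. Subscripts list the variables in order of
  differentiation, so \<open>u\<^sub>t\<^sub>t\<^sub>r\<^sub>r\<close> (written \<open>uttrr\<close>) is \<open>\<partial>\<^sup>2/\<partial>r\<^sup>2 (\<partial>\<^sup>2u/\<partial>\<theta>\<^sup>2)\<close>. Derivatives in \<open>\<theta>\<close> are
  taken within the wedge, i.e. one-sided on the edge \<open>\<theta> = 0\<close>.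

  On the separated functions \<open>e\<^bsup>\<theta>\<tau>\<^esup> f(r)\<close> the equation reads, with \<open>D = r d/dr\<close>,
  \<open>(D\<^sup>2 - \<alpha>\<^sup>2)(D\<^sup>2 + \<tau>\<^sup>2) f = r (D + 1/2)(D + 1) f\<close>, which is the equation satisfied by
  \<open>f(r) = |K\<^bsub>\<alpha>+i\<tau>\<^esub>(\<surd>r)|\<^sup>2\<close>. This is what forces the minus signs of the terms
  \<open>(\<alpha>\<^sup>2/r) \<partial>\<^sup>2u/\<partial>\<theta>\<^sup>2\<close> and \<open>u/2\<close>, which are misprinted as plus signs in the source.
\<close>

definition solves_wedge_pde :: "real \<Rightarrow> real \<Rightarrow> (real \<Rightarrow> real \<Rightarrow> complex) \<Rightarrow> bool" where
  "solves_wedge_pde \<alpha> \<beta> u \<longleftrightarrow>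
    (\<exists>ur urr urrr urrrr ut utt uttr uttrr. \<forall>r>0. \<forall>\<theta>\<in>{0..<\<beta>}.
       ((\<lambda>s. u s \<theta>) has_vector_derivative ur r \<theta>) (at r) \<and>
       ((\<lambda>s. ur s \<theta>) has_vector_derivative urr r \<theta>) (at r) \<and>
       ((\<lambda>s. urr s \<theta>) has_vector_derivative urrr r \<theta>) (at r) \<and>
       ((\<lambda>s. urrr s \<theta>) has_vector_derivative urrrr r \<theta>) (at r) \<and>
       ((\<lambda>t. u r t) has_vector_derivative ut r \<theta>) (at \<theta> within {0..<\<beta>}) \<and>
       ((\<lambda>t. ut r t) has_vector_derivative utt r \<theta>) (at \<theta> within {0..<\<beta>}) \<and>
       ((\<lambda>s. utt s \<theta>) has_vector_derivative uttr r \<theta>) (at r) \<and>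
       ((\<lambda>s. uttr s \<theta>) has_vector_derivative uttrr r \<theta>) (at r) \<and>
       r ^ 3 *\<^sub>R urrrr r \<theta> + r *\<^sub>R uttrr r \<theta> + (6 * r\<^sup>2) *\<^sub>R urrr r \<theta> + uttr r \<theta>
         + (r * (7 - \<alpha>\<^sup>2 - r)) *\<^sub>R urr r \<theta> - (\<alpha>\<^sup>2 / r) *\<^sub>R utt r \<theta>
         + (1 - \<alpha>\<^sup>2 - 5 / 2 * r) *\<^sub>R ur r \<theta> - (1 / 2) *\<^sub>R u r \<theta> = 0)"

end

theory Submission
  imports Defs
begin

text \<open>
  The equation is separated: for fixed \<open>\<tau>\<close> the function \<open>exp (\<theta>\<tau>) f(r)\<close> with \<open>f(r) = \<bar>K\<^sub>\<mu>(\<surd>r)\<bar>\<^sup>2\<close>, \<open>\<mu> = \<alpha> + i\<tau>\<close>, solves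
  it, and \<open>\<Psi>\<^sub>\<alpha>\<close> is a superposition of these solutions. Two things have to be shown: that \<open>f\<close> satisfies the
  fourth-order ordinary differential equation (\<open>K_sq_ode\<close>), and that it decays in \<open>\<tau>\<close>, with its derivatives,
  fast enough to differentiate under the integral sign.

  For the ordinary differential equation, the Bessel equation (\<open>macdonald_transform_ode\<close>) makes \<open>a(r) = K\<^sub>\<mu>(\<surd>r)\<close>
  and \<open>b = r a'\<close> solve a linear first-order system. Hence \<open>\<bar>a\<bar>\<^sup>2\<close>, \<open>\<bar>b\<bar>\<^sup>2\<close> and the real and imaginary part of
  \<open>a cnj b\<close> solve one as well, with coefficients polynomial in \<open>\<tau>\<close>, \<open>r\<close> and \<open>1/r\<close>. All derivatives of \<open>f\<close> are
  thereby combinations of these four quantities, and the equation becomes a polynomial identity.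

  For the decay, the line of integration of \<open>2 K\<^sub>\<mu>(x) = \<integral> exp (\<mu>t - x cosh t) dt\<close> is moved to \<open>Im t = \<plusminus>d\<close>,
  \<open>0 \<le> d < \<pi>/2\<close>, which produces the factor \<open>exp (- d \<bar>\<tau>\<bar>)\<close> (\<open>macdonald_transform_bound\<close>). So \<open>f\<close> and all its
  derivatives decay at every rate below \<open>\<pi>\<close>, polynomial factors in \<open>\<tau>\<close> included (\<open>decays_exp_K_sq_deriv\<close>).
  Against \<open>g\<close>, integrable with weight \<open>exp ((\<beta> - \<pi>) \<bar>\<tau>\<bar>)\<close>, this leaves room for \<open>exp (\<theta>\<tau>)\<close> when
  \<open>0 \<le> \<theta> < \<beta>\<close>. The same bound carries a factor \<open>exp (- x cos d)\<close>, from which the limit at infinity follows.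
\<close>

section \<open>Differentiation under the integral sign\<close>

text \<open>
  By the mean value inequality the difference quotients on the convex set are dominated by the same
  function \<open>w\<close> that bounds the derivative, so dominated convergence applies along every sequence
  tending to \<open>x\<close>. A one-sided derivative is the case in which \<open>x\<close> is an end point of \<open>S\<close>.
\<close>

lemma has_vector_derivative_integral_dominated:
  fixes f f' :: "real \<Rightarrow> 'a \<Rightarrow> 'b::{banach, second_countable_topology}"
  assumes S: "convex S" "x \<in> S"
    and int: "\<And>y. y \<in> S \<Longrightarrow> integrable M (f y)"
    and der: "\<And>y t. y \<in> S \<Longrightarrow> ((\<lambda>z. f z t) has_vector_derivative f' y t) (at y within S)"
    and bound: "\<And>y t. y \<in> S \<Longrightarrow> norm (f' y t) \<le> w t"
    and w: "integrable M w"
    and meas: "f' x \<in> borel_measurable M"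
  shows "((\<lambda>y. \<integral>t. f y t \<partial>M) has_vector_derivative (\<integral>t. f' x t \<partial>M)) (at x within S)"
proof -
  \<comment> \<open>\<open>R\<close> is the remainder of the linear approximation, divided by the increment.\<close>
  define R where "R y t = (1 / norm (y - x)) *\<^sub>R (f y t - (f x t + (y - x) *\<^sub>R f' x t))" for y t
  have int': "integrable M (f' x)"
    using w meas by (rule Bochner_Integration.integrable_bound) (use order_trans[OF bound[OF S(2)] abs_ge_self] in auto)
  have intR: "(1 / norm (y - x)) *\<^sub>R ((\<integral>t. f y t \<partial>M) - ((\<integral>t. f x t \<partial>M) + (y - x) *\<^sub>R (\<integral>t. f' x t \<partial>M)))
      = (\<integral>t. R y t \<partial>M)" if "y \<in> S" for y
    unfolding R_def using int[OF that] int[OF S(2)] int' by simp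
  have lim: "((\<lambda>y. R y t) \<longlongrightarrow> 0) (at x within S)" for t
    using der[OF S(2)] unfolding has_vector_derivative_def has_derivative_within R_def by blast
  have Rbound: "norm (R y t) \<le> 2 * w t" if "y \<in> S - {x}" for y t
  proof -
    have "norm (f y t - f x t) \<le> w t * norm (y - x)"
    proof (rule differentiable_bound[OF S(1)])
      show "((\<lambda>z. f z t) has_derivative (\<lambda>h. h *\<^sub>R f' y t)) (at y within S)" if "y \<in> S" for y
        using der[OF that] unfolding has_vector_derivative_def .
      show "onorm (\<lambda>h. h *\<^sub>R f' y t) \<le> w t" if "y \<in> S" for y
      proof (rule onorm_le)
        show "norm (h *\<^sub>R f' y t) \<le> w t * norm h" for h
          using mult_right_mono[OF bound[OF that, of t], of "\<bar>h\<bar>"] by (simp add: mult.commute)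
      qed
    qed (use that S in auto)
    moreover have "norm ((y - x) *\<^sub>R f' x t) \<le> w t * norm (y - x)"
      using mult_right_mono[OF bound[OF S(2), of t], of "\<bar>y - x\<bar>"] by (simp add: mult.commute)
    ultimately have "norm (f y t - (f x t + (y - x) *\<^sub>R f' x t)) \<le> 2 * w t * norm (y - x)"
      using norm_triangle_ineq4[of "f y t - f x t" "(y - x) *\<^sub>R f' x t"] unfolding diff_diff_add by linarith
    then show ?thesis
      using that unfolding R_def norm_scaleR by (simp add: pos_divide_le_eq)
  qed
  have "((\<lambda>y. \<integral>t. R y t \<partial>M) \<longlongrightarrow> 0) (at x within S)"
    unfolding tendsto_at_iff_sequentially
  proof (intro allI impI)
    fix X assume X: "\<forall>i. X i \<in> S - {x}" "X \<longlonglongrightarrow> x"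
    have "(\<lambda>i. \<integral>t. R (X i) t \<partial>M) \<longlonglongrightarrow> (\<integral>t. 0 \<partial>M)"
    proof (rule integral_dominated_convergence)
      show "R (X i) \<in> borel_measurable M" for i
      proof -
        have [measurable]: "f (X i) \<in> borel_measurable M" "f x \<in> borel_measurable M"
          using X(1) S(2) by (auto intro!: borel_measurable_integrable int)
        show ?thesis
          using meas unfolding R_def by measurable
      qed
      show "integrable M (\<lambda>t. 2 * w t)"
        using w by simp
      show "AE t in M. (\<lambda>i. R (X i) t) \<longlonglongrightarrow> 0"
        using lim X unfolding tendsto_at_iff_sequentially comp_def by auto
      show "AE t in M. norm (R (X i) t) \<le> 2 * w t" for i
        using Rbound X(1) by auto
    qed simp
    then show "((\<lambda>y. \<integral>t. R y t \<partial>M) \<circ> X) \<longlonglongrightarrow> 0"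
      by (simp add: comp_def)
  qed
  moreover have "eventually (\<lambda>y. (\<integral>t. R y t \<partial>M) = (1 / norm (y - x)) *\<^sub>R
      ((\<integral>t. f y t \<partial>M) - ((\<integral>t. f x t \<partial>M) + (y - x) *\<^sub>R (\<integral>t. f' x t \<partial>M)))) (at x within S)"
    using intR by (auto simp: eventually_at_filter)
  ultimately have "((\<lambda>y. (1 / norm (y - x)) *\<^sub>R
      ((\<integral>t. f y t \<partial>M) - ((\<integral>t. f x t \<partial>M) + (y - x) *\<^sub>R (\<integral>t. f' x t \<partial>M)))) \<longlongrightarrow> 0) (at x within S)"
    by (rule Lim_transform_eventually)
  then show ?thesis
    unfolding has_vector_derivative_def has_derivative_within
    by (simp add: bounded_linear_scaleR_left)
qed

section \<open>Moving a line of integration\<close>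

lemma integrable_exp_minus_abs: "integrable lborel (\<lambda>t::real. exp (- \<bar>t\<bar>))"
proof -
  have "(\<lambda>t. exp (- t) :: real) absolutely_integrable_on {0..}"
    using integrable_on_exp_minus_to_infinity[of 1 0]
    by (intro nonnegative_absolutely_integrable_1) auto
  then have int: "integrable lborel (\<lambda>t. indicator {0..} t * exp (- t) :: real)"
    unfolding set_integrable_def by (subst (asm) integrable_completion) auto
  have "integrable lborel (\<lambda>t. indicator {0..} t * exp (- t) + indicator {0..} (- t) * exp t :: real)"
    using int lborel_integrable_real_affine[OF int, of "-1" 0] by (intro Bochner_Integration.integrable_add) simp_all
  then show ?thesis
    by (rule Bochner_Integration.integrable_bound) (auto simp: indicator_def)
qed

lemma integrable_if_norm_le_exp_minus_abs:
  fixes f :: "real \<Rightarrow> complex"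
  assumes "continuous_on UNIV f" "\<And>t. norm (f t) \<le> C * exp (- \<bar>t\<bar>)"
  shows "integrable lborel f"
proof (rule Bochner_Integration.integrable_bound)
  show "integrable lborel (\<lambda>t::real. C * exp (- \<bar>t\<bar>))"
    using integrable_exp_minus_abs by simp
  show "f \<in> borel_measurable lborel"
    using assms(1) borel_measurable_continuous_onI by auto
  show "AE t in lborel. norm (f t) \<le> norm (C * exp (- \<bar>t\<bar>))"
    using order_trans[OF assms(2) abs_ge_self] by simp
qed

lemma integral_derivative_horizontal_line_eq_0:
  fixes \<Phi> \<Phi>' :: "complex \<Rightarrow> complex"
  assumes der: "\<And>z. (\<Phi> has_field_derivative \<Phi>' z) (at z)"
    and cont: "continuous_on UNIV \<Phi>'"
    and bound: "\<And>t. norm (\<Phi> (of_real t + \<i> * of_real s)) \<le> C * exp (- \<bar>t\<bar>)"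
    and bound': "\<And>t. norm (\<Phi>' (of_real t + \<i> * of_real s)) \<le> C' * exp (- \<bar>t\<bar>)"
  shows "(\<integral>t. \<Phi>' (of_real t + \<i> * of_real s) \<partial>lborel) = 0"
proof -
  let ?F = "\<lambda>t::real. \<Phi> (of_real t + \<i> * of_real s)"
  let ?f = "\<lambda>t::real. \<Phi>' (of_real t + \<i> * of_real s)"
  have conf: "continuous_on UNIV ?f"
    by (intro continuous_on_compose2[OF cont] continuous_intros) auto
  have lim: "(?F \<longlongrightarrow> 0) at_top" "(?F \<longlongrightarrow> 0) at_bot"
  proof -
    have "((\<lambda>t. C * exp (- \<bar>t::real\<bar>)) \<longlongrightarrow> C * 0) at_top"
      by (intro tendsto_intros filterlim_compose[OF exp_at_bot] filterlim_compose[OF filterlim_uminus_at_bot_at_top] filterlim_abs_real)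
    then show "(?F \<longlongrightarrow> 0) at_top"
      by (intro Lim_null_comparison[OF always_eventually[OF allI[OF bound]]]) simp
    have "((\<lambda>t. C * exp (- \<bar>t::real\<bar>)) \<longlongrightarrow> C * 0) at_bot"
      by (intro tendsto_intros filterlim_compose[OF exp_at_bot] filterlim_compose[OF filterlim_uminus_at_bot_at_top])
        (simp add: filterlim_at_bot_mirror filterlim_abs_real)
    then show "(?F \<longlongrightarrow> 0) at_bot"
      by (intro Lim_null_comparison[OF always_eventually[OF allI[OF bound]]]) simp
  qed
  have "(LBINT t=-\<infinity>..\<infinity>. ?f t) = 0 - 0"
  proof (rule interval_integral_FTC_integrable)
    show "(?F has_vector_derivative ?f t) (at t)" for t
    proof -
      have "((\<lambda>u. of_real u + \<i> * of_real s :: complex) has_vector_derivative 1) (at t)"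
        by (auto intro!: derivative_eq_intros)
      from field_vector_diff_chain_at[OF this der] show ?thesis
        by (simp add: comp_def)
    qed
    show "isCont ?f t" for t
      using conf by (simp add: continuous_on_eq_continuous_at)
    show "set_integrable lborel (einterval (- \<infinity>) \<infinity>) ?f"
      using integrable_if_norm_le_exp_minus_abs[OF conf bound'] by (simp add: set_integrable_def)
    show "((?F \<circ> real_of_ereal) \<longlongrightarrow> 0) (at_right (-\<infinity>))" "((?F \<circ> real_of_ereal) \<longlongrightarrow> 0) (at_left \<infinity>)"
      using lim by (simp_all add: ereal_tendsto_simps)
  qed simp
  then show ?thesis
    by (simp add: interval_lebesgue_integral_def set_lebesgue_integral_def)
qed

text \<open>
  Since \<open>\<Phi>\<close> is holomorphic, the derivative of \<open>\<Phi>(t + is)\<close> in \<open>s\<close> is \<open>\<i>\<close> times its derivative in \<open>t\<close>,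
  whose integral over the line vanishes; hence the integral does not depend on \<open>s\<close>. This replaces
  Cauchy's theorem for long rectangles.
\<close>

lemma integral_horizontal_line_shift:
  fixes \<Phi> \<Phi>' :: "complex \<Rightarrow> complex"
  assumes der: "\<And>z. (\<Phi> has_field_derivative \<Phi>' z) (at z)"
    and cont: "continuous_on UNIV \<Phi>'"
    and bound: "\<And>z. \<bar>Im z\<bar> \<le> \<bar>s\<bar> \<Longrightarrow> norm (\<Phi> z) \<le> C * exp (- \<bar>Re z\<bar>)"
    and bound': "\<And>z. \<bar>Im z\<bar> \<le> \<bar>s\<bar> \<Longrightarrow> norm (\<Phi>' z) \<le> C' * exp (- \<bar>Re z\<bar>)"
  shows "(\<integral>t. \<Phi> (of_real t + \<i> * of_real s) \<partial>lborel) = (\<integral>t. \<Phi> (of_real t) \<partial>lborel)"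
proof -
  let ?S = "{- \<bar>s\<bar>..\<bar>s\<bar>}"
  let ?\<Phi> = "\<lambda>y t. \<Phi> (of_real t + \<i> * of_real y)"
  let ?\<Phi>' = "\<lambda>y t. \<i> * \<Phi>' (of_real t + \<i> * of_real y)"
  have cont\<Phi>: "continuous_on UNIV \<Phi>"
    using der by (meson DERIV_isCont continuous_at_imp_continuous_on)
  have deriv: "((\<lambda>y. \<integral>t. ?\<Phi> y t \<partial>lborel) has_vector_derivative 0) (at y within ?S)" if y: "y \<in> ?S" for y
  proof -
    have "((\<lambda>y. \<integral>t. ?\<Phi> y t \<partial>lborel) has_vector_derivative (\<integral>t. ?\<Phi>' y t \<partial>lborel)) (at y within ?S)"
    proof (rule has_vector_derivative_integral_dominated[OF _ y])
      show "integrable lborel (?\<Phi> y)" if "y \<in> ?S" for y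
      proof (rule integrable_if_norm_le_exp_minus_abs)
        show "continuous_on UNIV (?\<Phi> y)"
          by (intro continuous_on_compose2[OF cont\<Phi>] continuous_intros) auto
        show "norm (?\<Phi> y t) \<le> C * exp (- \<bar>t\<bar>)" for t
          using bound[of "of_real t + \<i> * of_real y"] that by auto
      qed
      show "((\<lambda>y. ?\<Phi> y t) has_vector_derivative ?\<Phi>' y t) (at y within ?S)" for y t
      proof -
        have "((\<lambda>u. of_real t + \<i> * of_real u :: complex) has_vector_derivative \<i>) (at y)"
          by (auto intro!: derivative_eq_intros)
        from field_vector_diff_chain_at[OF this der] show ?thesis
          by (simp add: comp_def has_vector_derivative_at_within)
      qed
      show "norm (?\<Phi>' y t) \<le> C' * exp (- \<bar>t\<bar>)" if "y \<in> ?S" for y t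
        using bound'[of "of_real t + \<i> * of_real y"] that by (auto simp: norm_mult)
      show "integrable lborel (\<lambda>t::real. C' * exp (- \<bar>t\<bar>))"
        using integrable_exp_minus_abs by simp
      have "continuous_on UNIV (?\<Phi>' y)"
        by (intro continuous_intros continuous_on_compose2[OF cont]) auto
      then show "?\<Phi>' y \<in> borel_measurable lborel"
        using borel_measurable_continuous_onI by auto
    qed auto
    moreover have "(\<integral>t. \<Phi>' (of_real t + \<i> * of_real y) \<partial>lborel) = 0"
      by (rule integral_derivative_horizontal_line_eq_0[OF der cont, where C = C and C' = C'])
        (use bound[of "of_real _ + \<i> * of_real y"] bound'[of "of_real _ + \<i> * of_real y"] y in auto)
    ultimately show ?thesis
      by simp
  qed
  obtain c where "\<And>y. y \<in> ?S \<Longrightarrow> (\<integral>t. ?\<Phi> y t \<partial>lborel) = c"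
    using has_vector_derivative_zero_constant[OF _ deriv] by blast
  from this[of s] this[of 0] have "(\<integral>t. ?\<Phi> s t \<partial>lborel) = (\<integral>t. ?\<Phi> 0 t \<partial>lborel)"
    by (auto simp: abs_if)
  then show ?thesis
    by simp
qed

section \<open>Weighted Macdonald integrals\<close>

definition macdonald_phase :: "complex \<Rightarrow> real \<Rightarrow> complex \<Rightarrow> complex" where
  "macdonald_phase \<mu> x z = exp (\<mu> * z - of_real x * cosh z)"

text \<open>
  With \<open>P = 1\<close> this is \<open>2 K\<^sub>\<mu>(x)\<close>. The weights \<open>P\<close> are needed because the \<open>x\<close>-derivatives of \<open>K\<^sub>\<mu>\<close> carry
  powers of \<open>cosh\<close>.
\<close>

definition macdonald_transform :: "(complex \<Rightarrow> complex) \<Rightarrow> complex \<Rightarrow> real \<Rightarrow> complex" where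
  "macdonald_transform P \<mu> x = (\<integral>t. P (of_real t) * macdonald_phase \<mu> x (of_real t) \<partial>lborel)"

lemma norm_cosh_le_exp: "norm (cosh z) \<le> exp \<bar>Re z\<bar>" for z :: complex
proof -
  have "norm (exp z + exp (- z)) \<le> exp (Re z) + exp (- Re z)"
    using norm_triangle_ineq[of "exp z" "exp (- z)"] by simp
  moreover have "exp (Re z) + exp (- Re z) \<le> 2 * exp \<bar>Re z\<bar>"
    by (auto simp: abs_if)
  ultimately show ?thesis
    by (simp add: cosh_field_def norm_divide)
qed

lemma norm_sinh_le_exp: "norm (sinh z) \<le> exp \<bar>Re z\<bar>" for z :: complex
proof -
  have "norm (exp z - exp (- z)) \<le> exp (Re z) + exp (- Re z)"
    using norm_triangle_ineq4[of "exp z" "exp (- z)"] by simp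
  moreover have "exp (Re z) + exp (- Re z) \<le> 2 * exp \<bar>Re z\<bar>"
    by (auto simp: abs_if)
  ultimately show ?thesis
    by (simp add: sinh_field_def norm_divide)
qed

lemma Re_cosh: "Re (cosh z) = cosh (Re z) * cos (Im z)" for z :: complex
  by (simp add: cosh_def Re_exp algebra_simps)

text \<open>
  As \<open>t\<^sup>2 / 4 \<le> cosh t\<close>, completing the square makes the double exponential decay absorb any simple
  exponential growth; one factor \<open>exp (- \<bar>t\<bar>)\<close> is kept for integrability.
\<close>

lemma exp_linear_minus_cosh_le:
  fixes A c t :: real
  assumes "c > 0"
  shows "exp (A * \<bar>t\<bar> - c * cosh t) \<le> exp ((A + 1)\<^sup>2 / c) * exp (- \<bar>t\<bar>)"
proof -
  have "t\<^sup>2 / 4 \<le> cosh t"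
  proof -
    have "t\<^sup>2 / 4 \<le> exp \<bar>t\<bar> / 2"
      using exp_lower_Taylor_quadratic[of "\<bar>t\<bar>"] by simp
    also have "exp \<bar>t\<bar> / 2 \<le> cosh t"
      by (auto simp: cosh_field_def abs_if)
    finally show ?thesis .
  qed
  then have "c * (t\<^sup>2 / 4) \<le> c * cosh t"
    using assms by simp
  moreover have "(A + 1) * \<bar>t\<bar> \<le> c * (t\<^sup>2 / 4) + (A + 1)\<^sup>2 / c"
  proof -
    have "0 \<le> (c * \<bar>t\<bar> / 2 - (A + 1))\<^sup>2 / c"
      using assms by simp
    also have "\<dots> = c * (t\<^sup>2 / 4) + (A + 1)\<^sup>2 / c - (A + 1) * \<bar>t\<bar>"
      using assms by (simp add: power2_diff add_divide_distrib diff_divide_distrib)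
        (simp add: power2_eq_square field_simps)
    finally show ?thesis by simp
  qed
  ultimately show ?thesis
    by (simp add: exp_add[symmetric] algebra_simps)
qed

text \<open>
  On the strip \<open>\<bar>Im z\<bar> \<le> \<sigma> < \<pi>/2\<close> the real part of \<open>cosh z\<close> is at least \<open>cos \<sigma> cosh (Re z)\<close>. The excess of \<open>x\<close>
  over \<open>c\<close> is spent, through \<open>cosh \<ge> 1\<close>, on a factor that decays in \<open>x\<close>; the part \<open>c\<close> is left to control
  growth in \<open>Re z\<close> uniformly in \<open>x\<close>.
\<close>

lemma norm_macdonald_phase_le:
  assumes "\<bar>Im z\<bar> \<le> \<sigma>" "\<sigma> < pi / 2" "0 < c" "c \<le> x"
  shows "norm (macdonald_phase \<mu> x z) \<le>
    exp (- (x - c) * cos \<sigma>) * exp (- Im \<mu> * Im z) * exp (\<bar>Re \<mu>\<bar> * \<bar>Re z\<bar> - c * cos \<sigma> * cosh (Re z))"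
proof -
  have "cos \<sigma> > 0"
    using assms by (intro cos_gt_zero_pi) auto
  have "cos \<sigma> \<le> cos \<bar>Im z\<bar>"
    using assms by (subst cos_mono_le_eq) auto
  then have "cos \<sigma> \<le> cos (Im z)"
    by simp
  then have 1: "x * (cosh (Re z) * cos \<sigma>) \<le> x * (cosh (Re z) * cos (Im z))"
    using assms by (intro mult_left_mono) auto
  have "(x - c) * cos \<sigma> * 1 \<le> (x - c) * cos \<sigma> * cosh (Re z)"
    using assms \<open>cos \<sigma> > 0\<close> cosh_real_ge_1 by (intro mult_left_mono) auto
  moreover have "Re \<mu> * Re z \<le> \<bar>Re \<mu>\<bar> * \<bar>Re z\<bar>"
    by (metis abs_ge_self abs_mult)
  ultimately show ?thesis
    using 1 by (simp add: macdonald_phase_def Re_cosh exp_add[symmetric] algebra_simps)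
qed

lemma norm_weighted_macdonald_phase_le:
  assumes P: "norm (P z) \<le> B * exp (m * \<bar>Re z\<bar>)" and B: "0 \<le> B"
    and "\<bar>Im z\<bar> \<le> \<sigma>" "\<sigma> < pi / 2" "0 < c" "c \<le> x"
  shows "norm (P z * macdonald_phase \<mu> x z) \<le>
    B * exp ((m + \<bar>Re \<mu>\<bar> + 1)\<^sup>2 / (c * cos \<sigma>)) * exp (- (x - c) * cos \<sigma>) * exp (- Im \<mu> * Im z) * exp (- \<bar>Re z\<bar>)"
proof -
  have "cos \<sigma> > 0"
    using assms by (intro cos_gt_zero_pi) auto
  have "norm (P z * macdonald_phase \<mu> x z) \<le> (B * exp (m * \<bar>Re z\<bar>)) *
    (exp (- (x - c) * cos \<sigma>) * exp (- Im \<mu> * Im z) * exp (\<bar>Re \<mu>\<bar> * \<bar>Re z\<bar> - c * cos \<sigma> * cosh (Re z)))"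
    unfolding norm_mult using norm_macdonald_phase_le[of z \<sigma> c x \<mu>] assms by (intro mult_mono) auto
  also have "\<dots> = B * exp (- (x - c) * cos \<sigma>) * exp (- Im \<mu> * Im z) *
      exp ((m + \<bar>Re \<mu>\<bar>) * \<bar>Re z\<bar> - c * cos \<sigma> * cosh (Re z))"
    by (simp add: exp_add[symmetric] algebra_simps)
  also have "\<dots> \<le> B * exp (- (x - c) * cos \<sigma>) * exp (- Im \<mu> * Im z) *
      (exp ((m + \<bar>Re \<mu>\<bar> + 1)\<^sup>2 / (c * cos \<sigma>)) * exp (- \<bar>Re z\<bar>))"
    using B \<open>cos \<sigma> > 0\<close> assms by (intro mult_left_mono exp_linear_minus_cosh_le) auto
  finally show ?thesis
    by (simp add: mult_ac)
qed

lemma continuous_on_macdonald_phase [continuous_intros]: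
  "continuous_on S f \<Longrightarrow> continuous_on S (\<lambda>t. macdonald_phase \<mu> x (f t))"
  unfolding macdonald_phase_def by (intro continuous_intros)

lemma has_field_derivative_macdonald_phase:
  "(macdonald_phase \<mu> x has_field_derivative (\<mu> - of_real x * sinh z) * macdonald_phase \<mu> x z) (at z)"
  unfolding macdonald_phase_def by (auto intro!: derivative_eq_intros)

lemma integrable_weighted_macdonald_phase:
  assumes P: "continuous_on UNIV P" "\<And>z. norm (P z) \<le> B * exp (m * \<bar>Re z\<bar>)" and x: "x > 0"
  shows "integrable lborel (\<lambda>t. P (of_real t) * macdonald_phase \<mu> x (of_real t))"
proof (rule integrable_if_norm_le_exp_minus_abs)
  show "continuous_on UNIV (\<lambda>t. P (of_real t) * macdonald_phase \<mu> x (of_real t))"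
    by (intro continuous_intros continuous_on_compose2[OF P(1)]) auto
  have "norm (P 0) \<le> B"
    using P(2)[of 0] by simp
  then have "B \<ge> 0"
    by (rule order_trans[OF norm_ge_zero])
  then show "norm (P (of_real t) * macdonald_phase \<mu> x (of_real t)) \<le>
      (B * exp ((m + \<bar>Re \<mu>\<bar> + 1)\<^sup>2 / x)) * exp (- \<bar>t\<bar>)" for t
    using norm_weighted_macdonald_phase_le[of P "of_real t" B m 0 x x \<mu>] P(2)[of "of_real t"] \<open>B \<ge> 0\<close> x by simp
qed

text \<open>
  Both facts apply the line-shifting lemmas to the integrand \<open>P(z) exp (\<mu>z - x cosh z)\<close>, whose derivative is
  again of this form with the weight \<open>P' + P (\<mu> - x sinh)\<close>.
\<close>

lemma
  assumes der: "\<And>z. (P has_field_derivative P' z) (at z)" and P': "continuous_on UNIV P'"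
    and B: "\<And>z. norm (P z) \<le> B * exp (m * \<bar>Re z\<bar>)" "\<And>z. norm (P' z) \<le> B * exp (m * \<bar>Re z\<bar>)"
    and x: "x > 0" and s: "\<bar>s\<bar> < pi / 2"
  shows macdonald_transform_shift: "macdonald_transform P \<mu> x =
    (\<integral>t. P (of_real t + \<i> * of_real s) * macdonald_phase \<mu> x (of_real t + \<i> * of_real s) \<partial>lborel)"
    and macdonald_transform_by_parts: "(\<integral>t. (P' (of_real t) + P (of_real t) * (\<mu> - of_real x * sinh (of_real t))) * macdonald_phase \<mu> x (of_real t) \<partial>lborel) = 0"
proof -
  define Q where "Q z = P' z + P z * (\<mu> - of_real x * sinh z)" for z
  have "continuous_on UNIV P"
    using der by (meson DERIV_isCont continuous_at_imp_continuous_on)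
  then have "continuous_on UNIV Q"
    unfolding Q_def using P' by (intro continuous_intros)
  have "norm (P 0) \<le> B"
    using B(1)[of 0] by simp
  then have B0: "B \<ge> 0"
    by (rule order_trans[OF norm_ge_zero])
  have Q: "norm (Q z) \<le> (B * (1 + norm \<mu> + x)) * exp ((m + 1) * \<bar>Re z\<bar>)" for z
  proof -
    let ?e = "exp \<bar>Re z\<bar>"
    have e: "1 \<le> ?e" by simp
    have "norm (\<mu> - of_real x * sinh z) \<le> norm \<mu> + x * norm (sinh z)"
      using norm_triangle_ineq4[of \<mu> "of_real x * sinh z"] x by (simp add: norm_mult)
    also have "\<dots> \<le> norm \<mu> * ?e + x * ?e"
      using norm_sinh_le_exp[of z] x mult_left_mono[OF e, of "norm \<mu>"] by (intro add_mono) auto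
    finally have 1: "norm (\<mu> - of_real x * sinh z) \<le> (norm \<mu> + x) * ?e"
      by (simp add: algebra_simps)
    have "norm (Q z) \<le> norm (P' z) + norm (P z) * norm (\<mu> - of_real x * sinh z)"
      unfolding Q_def by (metis norm_mult norm_triangle_ineq)
    also have "\<dots> \<le> B * exp (m * \<bar>Re z\<bar>) * ?e + B * exp (m * \<bar>Re z\<bar>) * ((norm \<mu> + x) * ?e)"
    proof (intro add_mono mult_mono B 1)
      show "norm (P' z) \<le> B * exp (m * \<bar>Re z\<bar>) * ?e"
        using B(2)[of z] mult_left_mono[OF e, of "B * exp (m * \<bar>Re z\<bar>)"] B0 by simp
    qed (use B0 in auto)
    also have "\<dots> = (B * (1 + norm \<mu> + x)) * exp ((m + 1) * \<bar>Re z\<bar>)"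
      by (simp add: exp_add algebra_simps)
    finally show ?thesis .
  qed
  have dPhi: "((\<lambda>z. P z * macdonald_phase \<mu> x z) has_field_derivative Q z * macdonald_phase \<mu> x z) (at z)" for z
    using der[of z] has_field_derivative_macdonald_phase[of \<mu> x z]
    by (auto intro!: derivative_eq_intros simp: Q_def algebra_simps)
  have cont: "continuous_on UNIV (\<lambda>z. Q z * macdonald_phase \<mu> x z)"
    using \<open>continuous_on UNIV Q\<close> by (intro continuous_intros)
  \<comment> \<open>\<open>P\<close> and \<open>Q\<close> need the same bound, so it is shown for any weight \<open>R\<close> of exponential growth.\<close>
  have strip: "norm (R z * macdonald_phase \<mu> x z) \<le>
      (D * exp ((n + \<bar>Re \<mu>\<bar> + 1)\<^sup>2 / (x * cos \<bar>s\<bar>)) * exp (\<bar>Im \<mu>\<bar> * \<bar>s\<bar>)) * exp (- \<bar>Re z\<bar>)"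
    if R: "\<And>z. norm (R z) \<le> D * exp (n * \<bar>Re z\<bar>)" and D: "D \<ge> 0" and z: "\<bar>Im z\<bar> \<le> \<bar>s\<bar>" for R D n z
  proof -
    have "- Im \<mu> * Im z \<le> \<bar>Im \<mu>\<bar> * \<bar>s\<bar>"
      using mult_left_mono[OF z abs_ge_zero[of "Im \<mu>"]] abs_ge_minus_self[of "Im \<mu> * Im z"] unfolding abs_mult by simp
    have "norm (R z * macdonald_phase \<mu> x z) \<le> D * exp ((n + \<bar>Re \<mu>\<bar> + 1)\<^sup>2 / (x * cos \<bar>s\<bar>)) * exp (- (x - x) * cos \<bar>s\<bar>) *
        exp (- Im \<mu> * Im z) * exp (- \<bar>Re z\<bar>)"
      using norm_weighted_macdonald_phase_le[of R z, OF R D z s x order_refl] .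
    also have "\<dots> \<le> D * exp ((n + \<bar>Re \<mu>\<bar> + 1)\<^sup>2 / (x * cos \<bar>s\<bar>)) * exp (- (x - x) * cos \<bar>s\<bar>) *
        exp (\<bar>Im \<mu>\<bar> * \<bar>s\<bar>) * exp (- \<bar>Re z\<bar>)"
      using \<open>- Im \<mu> * Im z \<le> \<bar>Im \<mu>\<bar> * \<bar>s\<bar>\<close> D by (intro mult_right_mono mult_left_mono) auto
    finally show ?thesis
      by simp
  qed
  have D0: "B * (1 + norm \<mu> + x) \<ge> 0"
    using B0 x by simp
  show "macdonald_transform P \<mu> x =
    (\<integral>t. P (of_real t + \<i> * of_real s) * macdonald_phase \<mu> x (of_real t + \<i> * of_real s) \<partial>lborel)"
    unfolding macdonald_transform_def
    by (rule integral_horizontal_line_shift[OF dPhi cont strip[OF B(1) B0] strip[OF Q D0], symmetric]) auto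
  have zero: "\<bar>Im (of_real t + \<i> * of_real 0)\<bar> \<le> \<bar>s\<bar>" for t
    by simp
  have "(\<integral>t. Q (of_real t + \<i> * of_real 0) * macdonald_phase \<mu> x (of_real t + \<i> * of_real 0) \<partial>lborel) = 0"
    by (rule integral_derivative_horizontal_line_eq_0[OF dPhi cont])
      (use strip[OF B(1) B0 zero] strip[OF Q D0 zero] in auto)
  then show "(\<integral>t. (P' (of_real t) + P (of_real t) * (\<mu> - of_real x * sinh (of_real t))) * macdonald_phase \<mu> x (of_real t) \<partial>lborel) = 0"
    by (simp add: Q_def)
qed

text \<open>
  Shifting the line of integration by \<open>\<plusminus>i d\<close> turns the oscillation of \<open>exp (i\<tau>t)\<close> into the decay
  \<open>exp (- d \<bar>\<tau>\<bar>)\<close>. Every \<open>d < \<pi>/2\<close> is reached, but not \<open>\<pi>/2\<close> itself, where \<open>Re (cosh z)\<close> loses its positivity.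
\<close>

lemma macdonald_transform_bound:
  assumes der: "\<And>z. (P has_field_derivative P' z) (at z)" and P': "continuous_on UNIV P'"
    and B: "\<And>z. norm (P z) \<le> B * exp (m * \<bar>Re z\<bar>)" "\<And>z. norm (P' z) \<le> B * exp (m * \<bar>Re z\<bar>)"
    and d: "0 \<le> d" "d < pi / 2" and c: "0 < c"
  shows "\<exists>C. \<forall>x\<ge>c. \<forall>\<tau>. norm (macdonald_transform P (Complex \<alpha> \<tau>) x) \<le> C * exp (- (x - c) * cos d) * exp (- d * \<bar>\<tau>\<bar>)"
proof -
  define G where "G = B * exp ((m + \<bar>\<alpha>\<bar> + 1)\<^sup>2 / (c * cos d))"
  define I where "I = (\<integral>t. exp (- \<bar>t::real\<bar>) \<partial>lborel)"
  have "norm (P 0) \<le> B"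
    using B(1)[of 0] by simp
  then have B0: "B \<ge> 0"
    by (rule order_trans[OF norm_ge_zero])
  have "norm (macdonald_transform P (Complex \<alpha> \<tau>) x) \<le> (G * I) * exp (- (x - c) * cos d) * exp (- d * \<bar>\<tau>\<bar>)"
    if x: "x \<ge> c" for x \<tau>
  proof -
    \<comment> \<open>The sign of the shift is chosen so that the constant factor \<open>exp (- \<tau> s)\<close> of \<open>exp (\<mu> z)\<close> is small.\<close>
    define s where "s = (if \<tau> \<ge> 0 then d else - d)"
    have s: "\<bar>s\<bar> = d" "\<tau> * s = d * \<bar>\<tau>\<bar>"
      using d by (auto simp: s_def)
    let ?\<Phi> = "\<lambda>t. P (of_real t + \<i> * of_real s) * macdonald_phase (Complex \<alpha> \<tau>) x (of_real t + \<i> * of_real s)"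
    have "norm (macdonald_transform P (Complex \<alpha> \<tau>) x) = norm (\<integral>t. ?\<Phi> t \<partial>lborel)"
      using macdonald_transform_shift[OF der P' B, of x s] x c s d by simp
    also have "\<dots> \<le> (\<integral>t. (G * exp (- (x - c) * cos d) * exp (- d * \<bar>\<tau>\<bar>)) * exp (- \<bar>t\<bar>) \<partial>lborel)"
    proof (rule Bochner_Integration.integral_norm_bound_integral)
      have pt: "norm (?\<Phi> t) \<le> (G * exp (- (x - c) * cos d) * exp (- d * \<bar>\<tau>\<bar>)) * exp (- \<bar>t\<bar>)" for t
        using norm_weighted_macdonald_phase_le[of P "of_real t + \<i> * of_real s", OF B(1) B0, of d c x "Complex \<alpha> \<tau>"] s d c x
        by (simp add: G_def)
      then show "\<And>t. norm (?\<Phi> t) \<le> (G * exp (- (x - c) * cos d) * exp (- d * \<bar>\<tau>\<bar>)) * exp (- \<bar>t\<bar>)" .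
      have "continuous_on UNIV P"
        using der by (meson DERIV_isCont continuous_at_imp_continuous_on)
      then have "continuous_on UNIV ?\<Phi>"
        by (intro continuous_intros continuous_on_compose2[OF \<open>continuous_on UNIV P\<close>]) auto
      then show "integrable lborel ?\<Phi>"
        using pt by (rule integrable_if_norm_le_exp_minus_abs)
    qed (use integrable_exp_minus_abs in auto)
    also have "\<dots> = (G * I) * exp (- (x - c) * cos d) * exp (- d * \<bar>\<tau>\<bar>)"
      by (simp add: I_def)
    finally show ?thesis .
  qed
  then show ?thesis
    by blast
qed

lemma has_vector_derivative_macdonald_transform:
  assumes P: "continuous_on UNIV P" "\<And>z. norm (P z) \<le> B * exp (m * \<bar>Re z\<bar>)" and x: "x > 0"
  shows "(macdonald_transform P \<mu> has_vector_derivative - macdonald_transform (\<lambda>z. cosh z * P z) \<mu> x) (at x)"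
proof -
  let ?S = "{x / 2<..}"
  have "norm (P 0) \<le> B"
    using P(2)[of 0] by simp
  then have B0: "B \<ge> 0"
    by (rule order_trans[OF norm_ge_zero])
  have B': "norm (cosh z * P z) \<le> B * exp ((m + 1) * \<bar>Re z\<bar>)" for z
  proof -
    have "norm (cosh z * P z) \<le> exp \<bar>Re z\<bar> * (B * exp (m * \<bar>Re z\<bar>))"
      unfolding norm_mult using norm_cosh_le_exp[of z] P(2)[of z] by (intro mult_mono) auto
    then show ?thesis
      by (simp add: exp_add algebra_simps)
  qed
  let ?w = "\<lambda>t. (B * exp ((m + 1 + \<bar>Re \<mu>\<bar> + 1)\<^sup>2 / (x / 2))) * exp (- \<bar>t::real\<bar>)"
  have "((\<lambda>y. \<integral>t. P (of_real t) * macdonald_phase \<mu> y (of_real t) \<partial>lborel) has_vector_derivative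
      (\<integral>t. - (cosh (of_real t) * P (of_real t) * macdonald_phase \<mu> x (of_real t)) \<partial>lborel)) (at x within ?S)"
  proof (rule has_vector_derivative_integral_dominated)
    show "integrable lborel (\<lambda>t. P (of_real t) * macdonald_phase \<mu> y (of_real t))" if "y \<in> ?S" for y
      using that x by (intro integrable_weighted_macdonald_phase[OF P]) auto
    show "((\<lambda>y. P (of_real t) * macdonald_phase \<mu> y (of_real t)) has_vector_derivative
        - (cosh (of_real t) * P (of_real t) * macdonald_phase \<mu> y (of_real t))) (at y within ?S)" for y t
    proof -
      have "((\<lambda>w. P (of_real t :: complex) * exp (\<mu> * of_real t - w * cosh (of_real t))) has_field_derivative
        - (cosh (of_real t) * P (of_real t) * macdonald_phase \<mu> y (of_real t))) (at (of_real y))"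
        unfolding macdonald_phase_def by (auto intro!: derivative_eq_intros)
      from has_vector_derivative_real_field[OF this] show ?thesis
        unfolding macdonald_phase_def by (rule has_vector_derivative_at_within)
    qed
    show "norm (- (cosh (of_real t) * P (of_real t) * macdonald_phase \<mu> y (of_real t))) \<le> ?w t" if "y \<in> ?S" for y t
    proof -
      have "norm (cosh (of_real t) * P (of_real t) * macdonald_phase \<mu> y (of_real t)) \<le>
          B * exp ((m + 1 + \<bar>Re \<mu>\<bar> + 1)\<^sup>2 / (x / 2)) * exp (- (y - x / 2)) * exp (- \<bar>t\<bar>)"
        using norm_weighted_macdonald_phase_le[of "\<lambda>z. cosh z * P z" "of_real t", OF B' B0, of 0 "x / 2" y \<mu>] that x by simp
      also have "\<dots> \<le> B * exp ((m + 1 + \<bar>Re \<mu>\<bar> + 1)\<^sup>2 / (x / 2)) * 1 * exp (- \<bar>t\<bar>)"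
        using that B0 by (intro mult_right_mono mult_left_mono) auto
      finally show ?thesis
        by simp
    qed
    show "(\<lambda>t. - (cosh (of_real t) * P (of_real t) * macdonald_phase \<mu> x (of_real t))) \<in> borel_measurable lborel"
      using integrable_weighted_macdonald_phase[OF continuous_on_mult[OF continuous_on_cosh[OF continuous_on_id] P(1)] B' x, of \<mu>]
      by (intro borel_measurable_uminus borel_measurable_integrable)
  qed (use x integrable_exp_minus_abs in auto)
  then show ?thesis
    using x by (simp add: macdonald_transform_def[abs_def] at_within_open[of x ?S])
qed

text \<open>
  This is the modified Bessel equation \<open>x\<^sup>2 K'' + x K' = (x\<^sup>2 + \<mu>\<^sup>2) K\<close>, the derivatives being expressed through
  weights. It says that the integral of the derivative of \<open>(- x sinh t - \<mu>) exp (\<mu>t - x cosh t)\<close> vanishes.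
\<close>

lemma macdonald_transform_ode:
  assumes x: "x > 0"
  shows "of_real (x\<^sup>2) * macdonald_transform (\<lambda>z. cosh z * cosh z) \<mu> x - of_real x * macdonald_transform cosh \<mu> x
    = (of_real (x\<^sup>2) + \<mu>\<^sup>2) * macdonald_transform (\<lambda>z. 1) \<mu> x"
proof -
  define P where "P z = - of_real x * sinh z - \<mu>" for z :: complex
  define P' where "P' z = - of_real x * cosh z" for z :: complex
  let ?E = "\<lambda>t::real. macdonald_phase \<mu> x (of_real t)"
  have e: "1 \<le> exp \<bar>Re z\<bar>" for z
    by simp
  have "norm (P z) \<le> (x + norm \<mu>) * exp (1 * \<bar>Re z\<bar>)" for z
  proof -
    have "norm (P z) \<le> x * norm (sinh z) + norm \<mu>"
      using norm_triangle_ineq4[of "- of_real x * sinh z" \<mu>] x by (simp add: P_def norm_mult)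
    also have "\<dots> \<le> x * exp \<bar>Re z\<bar> + norm \<mu> * exp \<bar>Re z\<bar>"
      using norm_sinh_le_exp[of z] x mult_left_mono[OF e, of "norm \<mu>"] by (intro add_mono) auto
    finally show ?thesis
      by (simp add: algebra_simps)
  qed
  moreover have "norm (P' z) \<le> (x + norm \<mu>) * exp (1 * \<bar>Re z\<bar>)" for z
  proof -
    have "norm (P' z) = x * norm (cosh z)"
      using x by (simp add: P'_def norm_mult)
    also have "\<dots> \<le> (x + norm \<mu>) * exp (1 * \<bar>Re z\<bar>)"
      using norm_cosh_le_exp[of z] x by (intro mult_mono) auto
    finally show ?thesis .
  qed
  moreover have "(P has_field_derivative P' z) (at z)" for z
    unfolding P_def P'_def by (auto intro!: derivative_eq_intros)
  moreover have "continuous_on UNIV P'"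
    unfolding P'_def by (intro continuous_intros)
  ultimately have "(\<integral>t. (P' (of_real t) + P (of_real t) * (\<mu> - of_real x * sinh (of_real t))) * ?E t \<partial>lborel) = 0"
    using macdonald_transform_by_parts[of P P' "x + norm \<mu>" 1 x 0 \<mu>] x by simp
  moreover have "(P' z + P z * (\<mu> - of_real x * sinh z)) * w =
      of_real (x\<^sup>2) * (cosh z * cosh z * w) - of_real x * (cosh z * w) - (of_real (x\<^sup>2) + \<mu>\<^sup>2) * (1 * w)" for z w
  proof -
    have "sinh z ^ 2 = cosh z * cosh z - 1"
      using hyperbolic_pythagoras[of z] by (simp add: power2_eq_square algebra_simps)
    moreover have "P' z + P z * (\<mu> - of_real x * sinh z) =
      of_real (x\<^sup>2) * sinh z ^ 2 - of_real x * cosh z - \<mu>\<^sup>2"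
      by (simp add: P_def P'_def algebra_simps power2_eq_square)
    ultimately have "P' z + P z * (\<mu> - of_real x * sinh z) =
      of_real (x\<^sup>2) * (cosh z * cosh z - 1) - of_real x * cosh z - \<mu>\<^sup>2"
      by simp
    then show ?thesis
      by (simp only:) (simp add: algebra_simps)
  qed
  ultimately have "(\<integral>t. of_real (x\<^sup>2) * (cosh (of_real t) * cosh (of_real t) * ?E t) - of_real x * (cosh (of_real t) * ?E t)
      - (of_real (x\<^sup>2) + \<mu>\<^sup>2) * (1 * ?E t) \<partial>lborel) = 0"
    by simp
  moreover have "integrable lborel (\<lambda>t. cosh (of_real t) * cosh (of_real t) * ?E t)"
  proof (rule integrable_weighted_macdonald_phase[where P = "\<lambda>z. cosh z * cosh z"])
    show "norm (cosh z * cosh z) \<le> 1 * exp (2 * \<bar>Re z\<bar>)" for z :: complex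
      using mult_mono[OF norm_cosh_le_exp[of z] norm_cosh_le_exp[of z]] by (simp add: norm_mult exp_add[symmetric])
  qed (use x in \<open>auto intro!: continuous_intros\<close>)
  moreover have "integrable lborel (\<lambda>t. cosh (of_real t) * ?E t)"
    by (rule integrable_weighted_macdonald_phase[where P = cosh and B = 1 and m = 1])
      (use x norm_cosh_le_exp in \<open>auto intro!: continuous_intros\<close>)
  moreover have "integrable lborel (\<lambda>t. 1 * ?E t)"
    by (rule integrable_weighted_macdonald_phase[where P = "\<lambda>_. 1" and B = 1 and m = 0]) (use x in auto)
  ultimately show ?thesis
    by (simp add: macdonald_transform_def)
qed

text \<open>
  Macdonald's integrand \<open>exp (- x cosh t) cosh (\<mu>t)\<close> is the even part of \<open>exp (\<mu>t - x cosh t)\<close>.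
\<close>

lemma Macdonald_K_eq_transform:
  assumes x: "x > 0"
  shows "Macdonald_K \<mu> x = macdonald_transform (\<lambda>z. 1) \<mu> x / 2"
proof -
  define h where "h t = exp (- x * cosh t) *\<^sub>R cosh (\<mu> * of_real t)" for t :: real
  have conth: "continuous_on UNIV h"
    unfolding h_def by (intro continuous_intros)
  have [measurable]: "h \<in> borel_measurable borel"
    using conth by (rule borel_measurable_continuous_onI)
  have even: "h (- t) = h t" for t
    by (simp add: h_def)
  let ?E = "\<lambda>t::real. 1 * macdonald_phase \<mu> x (of_real t)"
  have intE: "integrable lborel ?E"
    by (rule integrable_weighted_macdonald_phase[where P = "\<lambda>_. 1" and B = 1 and m = 0]) (use x in auto)
  have intE': "integrable lborel (\<lambda>t. ?E (- t))"
    using lborel_integrable_real_affine[OF intE, of "-1" 0] by simp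
  have hE: "2 * h t = ?E t + ?E (- t)" for t
  proof -
    have "cosh (of_real t) = (of_real (cosh t) :: complex)"
      by (simp add: cosh_field_def exp_of_real flip: of_real_minus)
    then have "?E t = exp (\<mu> * of_real t) * of_real (exp (- x * cosh t))"
      and "?E (- t) = exp (- (\<mu> * of_real t)) * of_real (exp (- x * cosh t))"
      by (simp_all add: macdonald_phase_def exp_diff exp_minus exp_of_real divide_inverse flip: of_real_mult of_real_inverse)
    then show ?thesis
      by (simp add: h_def cosh_field_def scaleR_conv_of_real algebra_simps)
  qed
  have "(\<integral>t. ?E (- t) \<partial>lborel) = (\<integral>t. ?E t \<partial>lborel)"
    using lborel_integral_real_affine[of "-1" ?E 0] by simp
  then have "(\<integral>t. 2 * h t \<partial>lborel) = 2 * macdonald_transform (\<lambda>z. 1) \<mu> x"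
    unfolding hE using intE intE' by (simp add: macdonald_transform_def)
  moreover have inth: "integrable lborel h"
  proof -
    have "integrable lborel (\<lambda>t. (2 * h t) / 2)"
      unfolding hE by (intro integrable_divide Bochner_Integration.integrable_add intE intE')
    then show ?thesis by simp
  qed
  moreover have "(\<integral>t. h t \<partial>lborel) = 2 * Macdonald_K \<mu> x"
  proof -
    let ?g = "\<lambda>t. indicator {0..} t *\<^sub>R h t"
    have intg: "integrable lborel ?g"
      using inth by (intro integrable_mult_indicator) auto
    have intg': "integrable lborel (\<lambda>t. ?g (- t))"
      using lborel_integrable_real_affine[OF intg, of "-1" 0] by simp
    have "(\<integral>t. h t \<partial>lborel) = (\<integral>t. ?g t + ?g (- t) \<partial>lborel)"
    proof (rule integral_cong_AE)
      have "AE t in lborel. t \<noteq> (0::real)"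
        by (rule AE_lborel_singleton)
      then show "AE t in lborel. h t = ?g t + ?g (- t)"
        by eventually_elim (auto simp: indicator_def even)
    qed measurable
    also have "\<dots> = (\<integral>t. ?g t \<partial>lborel) + (\<integral>t. ?g (- t) \<partial>lborel)"
      using intg intg' by simp
    also have "(\<integral>t. ?g (- t) \<partial>lborel) = (\<integral>t. ?g t \<partial>lborel)"
      using lborel_integral_real_affine[of "-1" ?g 0] by simp
    also have "(\<integral>t. ?g t \<partial>lborel) = (\<integral>t. ?g t \<partial>lebesgue)"
      by (rule integral_completion[symmetric]) measurable
    also have "\<dots> = Macdonald_K \<mu> x"
      by (simp add: Macdonald_K_def set_lebesgue_integral_def h_def)
    finally show ?thesis
      by simp
  qed
  ultimately show ?thesis
    by (simp add: field_simps)
qed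

lemma borel_measurable_macdonald_transform:
  assumes "continuous_on UNIV P"
  shows "(\<lambda>\<tau>. macdonald_transform P (Complex \<alpha> \<tau>) x) \<in> borel_measurable borel"
proof -
  have "continuous_on UNIV (\<lambda>p::real \<times> real. P (of_real (snd p)) * macdonald_phase (Complex \<alpha> (fst p)) x (of_real (snd p)))"
    unfolding macdonald_phase_def Complex_eq
    by (intro continuous_intros continuous_on_compose2[OF assms]) auto
  then have "(\<lambda>p::real \<times> real. P (of_real (snd p)) * macdonald_phase (Complex \<alpha> (fst p)) x (of_real (snd p)))
      \<in> borel_measurable (borel \<Otimes>\<^sub>M lborel)"
    unfolding borel_prod[symmetric, where 'a = real and 'b = real]
    by (subst measurable_cong_sets[OF sets_pair_measure_cong[OF refl sets_lborel] refl])
      (simp add: borel_prod borel_measurable_continuous_onI)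
  then show ?thesis
    unfolding macdonald_transform_def
    by (intro lborel.borel_measurable_lebesgue_integral) (simp add: case_prod_beta')
qed

section \<open>Kernels of exponential decay\<close>

text \<open>
  Decay in \<open>\<tau>\<close> at every exponential rate below \<open>D\<close>, locally uniformly in \<open>r > 0\<close>. Leaving the rate \<open>D\<close> itself
  open makes the notion insensitive to polynomial factors: \<open>D = 0\<close> is subexponential growth, so continuous
  functions of \<open>r\<close> and powers of \<open>\<tau>\<close> are admissible coefficients, and rates add up under multiplication.
\<close>

definition decays_exp :: "real \<Rightarrow> (real \<Rightarrow> real \<Rightarrow> 'a::{banach, second_countable_topology}) \<Rightarrow> bool" where
  "decays_exp D h \<longleftrightarrow> (\<forall>r>0. h r \<in> borel_measurable borel) \<and>
    (\<forall>d<D. \<forall>l>0. \<forall>u. \<exists>C. \<forall>r\<in>{l..u}. \<forall>\<tau>. norm (h r \<tau>) \<le> C * exp (- d * \<bar>\<tau>\<bar>))"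

lemma decays_expD:
  assumes "decays_exp D h" "d < D" "l > 0"
  shows "\<exists>C. \<forall>r\<in>{l..u}. \<forall>\<tau>. norm (h r \<tau>) \<le> C * exp (- d * \<bar>\<tau>\<bar>)"
  using assms unfolding decays_exp_def by simp

lemma decays_exp_measurable: "decays_exp D h \<Longrightarrow> r > 0 \<Longrightarrow> h r \<in> borel_measurable borel"
  by (simp add: decays_exp_def)

lemma decays_exp_add:
  assumes "decays_exp D h" "decays_exp D k"
  shows "decays_exp D (\<lambda>r \<tau>. h r \<tau> + k r \<tau>)"
  unfolding decays_exp_def
proof (intro conjI allI impI)
  show "(\<lambda>\<tau>. h r \<tau> + k r \<tau>) \<in> borel_measurable borel" if "r > 0" for r
    using assms[THEN decays_exp_measurable, OF that] by measurable
  fix d l u :: real assume dl: "d < D" "l > 0"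
  obtain C where C: "\<forall>r\<in>{l..u}. \<forall>\<tau>. norm (h r \<tau>) \<le> C * exp (- d * \<bar>\<tau>\<bar>)"
    using decays_expD[OF assms(1) dl, where u = u] ..
  obtain C' where C': "\<forall>r\<in>{l..u}. \<forall>\<tau>. norm (k r \<tau>) \<le> C' * exp (- d * \<bar>\<tau>\<bar>)"
    using decays_expD[OF assms(2) dl, where u = u] ..
  have "norm (h r \<tau> + k r \<tau>) \<le> (C + C') * exp (- d * \<bar>\<tau>\<bar>)" if "r \<in> {l..u}" for r \<tau>
    using norm_triangle_ineq[of "h r \<tau>" "k r \<tau>"] C[rule_format, OF that, of \<tau>] C'[rule_format, OF that, of \<tau>] by (simp add: distrib_right)
  then show "\<exists>C. \<forall>r\<in>{l..u}. \<forall>\<tau>. norm (h r \<tau> + k r \<tau>) \<le> C * exp (- d * \<bar>\<tau>\<bar>)"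
    by (intro exI ballI allI)
qed

text \<open>
  A rate \<open>d < D + E\<close> splits into a rate below \<open>D\<close> and a rate below \<open>E\<close>.
\<close>

lemma decays_exp_mult:
  fixes h k :: "real \<Rightarrow> real \<Rightarrow> 'a::{banach, second_countable_topology, real_normed_algebra}"
  assumes "decays_exp D h" "decays_exp E k"
  shows "decays_exp (D + E) (\<lambda>r \<tau>. h r \<tau> * k r \<tau>)"
  unfolding decays_exp_def
proof (intro conjI allI impI)
  show "(\<lambda>\<tau>. h r \<tau> * k r \<tau>) \<in> borel_measurable borel" if "r > 0" for r
    using assms[THEN decays_exp_measurable, OF that] by measurable
  fix d l u :: real assume dl: "d < D + E" "l > 0"
  define e where "e = (D + E - d) / 2"
  have e: "D - e < D" "E - e < E" "d = (D - e) + (E - e)"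
    using dl by (auto simp: e_def field_simps)
  obtain C where C: "\<forall>r\<in>{l..u}. \<forall>\<tau>. norm (h r \<tau>) \<le> C * exp (- (D - e) * \<bar>\<tau>\<bar>)"
    using decays_expD[OF assms(1) e(1) dl(2), where u = u] ..
  obtain C' where C': "\<forall>r\<in>{l..u}. \<forall>\<tau>. norm (k r \<tau>) \<le> C' * exp (- (E - e) * \<bar>\<tau>\<bar>)"
    using decays_expD[OF assms(2) e(2) dl(2), where u = u] ..
  have "norm (h r \<tau> * k r \<tau>) \<le> (C * C') * exp (- d * \<bar>\<tau>\<bar>)" if "r \<in> {l..u}" for r \<tau>
  proof -
    have "norm (h r \<tau> * k r \<tau>) \<le> norm (h r \<tau>) * norm (k r \<tau>)"
      by (rule norm_mult_ineq)
    also have "\<dots> \<le> (C * exp (- (D - e) * \<bar>\<tau>\<bar>)) * (C' * exp (- (E - e) * \<bar>\<tau>\<bar>))"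
      using C[rule_format, OF that, of \<tau>] C'[rule_format, OF that, of \<tau>] by (intro mult_mono order_trans[OF norm_ge_zero C[rule_format, OF that]]) auto
    also have "\<dots> = (C * C') * exp (- d * \<bar>\<tau>\<bar>)"
      unfolding e(3) by (simp add: exp_add[symmetric] algebra_simps)
    finally show ?thesis .
  qed
  then show "\<exists>C. \<forall>r\<in>{l..u}. \<forall>\<tau>. norm (h r \<tau> * k r \<tau>) \<le> C * exp (- d * \<bar>\<tau>\<bar>)"
    by (intro exI ballI allI)
qed

lemma decays_exp_coeff:
  fixes h k :: "real \<Rightarrow> real \<Rightarrow> 'a::{banach, second_countable_topology, real_normed_algebra}"
  assumes "decays_exp 0 h" "decays_exp D k"
  shows "decays_exp D (\<lambda>r \<tau>. h r \<tau> * k r \<tau>)"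
  using decays_exp_mult[OF assms] by simp

lemma decays_exp_compose_contraction:
  assumes h: "decays_exp D h" and L: "continuous_on UNIV L" "\<And>x. norm (L x) \<le> norm x"
  shows "decays_exp D (\<lambda>r \<tau>. L (h r \<tau>))"
  unfolding decays_exp_def
proof (intro conjI allI impI)
  show "(\<lambda>\<tau>. L (h r \<tau>)) \<in> borel_measurable borel" if "r > 0" for r
    using measurable_compose[OF decays_exp_measurable[OF h that] borel_measurable_continuous_onI[OF L(1)]] .
  fix d l u :: real assume dl: "d < D" "l > 0"
  show "\<exists>C. \<forall>r\<in>{l..u}. \<forall>\<tau>. norm (L (h r \<tau>)) \<le> C * exp (- d * \<bar>\<tau>\<bar>)"
  proof -
    obtain C where C: "\<forall>r\<in>{l..u}. \<forall>\<tau>. norm (h r \<tau>) \<le> C * exp (- d * \<bar>\<tau>\<bar>)"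
      using decays_expD[OF h dl, where u = u] ..
    then show ?thesis
      by (intro exI[of _ C] ballI allI order_trans[OF L(2)]) simp
  qed
qed

lemma decays_exp_of_continuous:
  assumes "continuous_on {0<..} \<phi>"
  shows "decays_exp 0 (\<lambda>r _. \<phi> r)"
  unfolding decays_exp_def
proof (intro conjI allI impI)
  fix d l u :: real assume dl: "d < 0" "l > 0"
  have "bounded (\<phi> ` {l..u})"
    using dl assms by (intro compact_imp_bounded compact_continuous_image) (auto intro: continuous_on_subset)
  then obtain C where C: "\<And>r. r \<in> {l..u} \<Longrightarrow> norm (\<phi> r) \<le> C"
    unfolding bounded_iff by blast
  have "norm (\<phi> r) \<le> \<bar>C\<bar> * exp (- d * \<bar>\<tau>\<bar>)" if "r \<in> {l..u}" for r \<tau>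
  proof -
    have "norm (\<phi> r) \<le> \<bar>C\<bar> * 1"
      using C[OF that] by simp
    also have "\<dots> \<le> \<bar>C\<bar> * exp (- d * \<bar>\<tau>\<bar>)"
      using dl by (intro mult_left_mono) (auto simp: mult_nonpos_nonneg)
    finally show ?thesis .
  qed
  then show "\<exists>C. \<forall>r\<in>{l..u}. \<forall>\<tau>. norm (\<phi> r) \<le> C * exp (- d * \<bar>\<tau>\<bar>)"
    by (intro exI ballI allI)
qed simp

lemma decays_exp_tau: "decays_exp 0 (\<lambda>_ \<tau>. \<tau>)"
  unfolding decays_exp_def
proof (intro conjI allI impI)
  fix d l u :: real assume dl: "d < 0" "l > 0"
  have "norm \<tau> \<le> 1 / (- d) * exp (- d * \<bar>\<tau>\<bar>)" for \<tau>
    using exp_ge_add_one_self[of "- d * \<bar>\<tau>\<bar>"] dl by (simp add: field_simps)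
  then show "\<exists>C. \<forall>r\<in>{l..u}. \<forall>\<tau>. norm \<tau> \<le> C * exp (- d * \<bar>\<tau>\<bar>)"
    by (intro exI ballI allI)
qed simp

lemma decays_exp_power: "decays_exp 0 k \<Longrightarrow> decays_exp 0 (\<lambda>r \<tau>. k r \<tau> ^ n)" for k :: "real \<Rightarrow> real \<Rightarrow> real"
proof (induction n)
  case 0
  show ?case
    using decays_exp_of_continuous[of "\<lambda>_. 1 :: real"] by simp
next
  case (Suc n)
  then show ?case
    by (simp add: decays_exp_coeff)
qed

lemma decays_exp_uminus: "decays_exp D h \<Longrightarrow> decays_exp D (\<lambda>r \<tau>. - h r \<tau>)"
  by (erule decays_exp_compose_contraction) (auto intro: continuous_intros)

lemma decays_exp_diff:
  "decays_exp D h \<Longrightarrow> decays_exp D k \<Longrightarrow> decays_exp D (\<lambda>r \<tau>. h r \<tau> - k r \<tau>)"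
  using decays_exp_add[OF _ decays_exp_uminus, of D h k] by simp

lemma decays_exp_macdonald_transform:
  assumes der: "\<And>z. (P has_field_derivative P' z) (at z)" and P': "continuous_on UNIV P'"
    and B: "\<And>z. norm (P z) \<le> B * exp (m * \<bar>Re z\<bar>)" "\<And>z. norm (P' z) \<le> B * exp (m * \<bar>Re z\<bar>)"
  shows "decays_exp (pi / 2) (\<lambda>r \<tau>. macdonald_transform P (Complex \<alpha> \<tau>) (sqrt r))"
  unfolding decays_exp_def
proof (intro conjI allI impI)
  have "continuous_on UNIV P"
    using der by (meson DERIV_isCont continuous_at_imp_continuous_on)
  then show "(\<lambda>\<tau>. macdonald_transform P (Complex \<alpha> \<tau>) (sqrt r)) \<in> borel_measurable borel" for r
    by (rule borel_measurable_macdonald_transform)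
  fix d l u :: real assume dl: "d < pi / 2" "l > 0"
  \<comment> \<open>A negative rate is weaker than the rate \<open>0\<close>, which the bound covers.\<close>
  define d' where "d' = max d 0"
  have d': "0 \<le> d'" "d' < pi / 2" "d \<le> d'"
    using dl by (simp_all add: d'_def max_def)
  obtain C where C: "\<forall>x\<ge>sqrt l. \<forall>\<tau>. norm (macdonald_transform P (Complex \<alpha> \<tau>) x)
      \<le> C * exp (- (x - sqrt l) * cos d') * exp (- d' * \<bar>\<tau>\<bar>)"
    using macdonald_transform_bound[OF der P' B d'(1,2), of "sqrt l" \<alpha>] dl by auto
  have "cos d' \<ge> 0"
    using d' by (intro cos_ge_zero) auto
  have exponent: "- (sqrt r - sqrt l) * cos d' \<le> 0" if "r \<in> {l..u}" for r
    using that \<open>cos d' \<ge> 0\<close> by (intro mult_nonpos_nonneg) auto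
  have "norm (macdonald_transform P (Complex \<alpha> \<tau>) (sqrt r)) \<le> \<bar>C\<bar> * exp (- d * \<bar>\<tau>\<bar>)" if "r \<in> {l..u}" for r \<tau>
  proof -
    have "norm (macdonald_transform P (Complex \<alpha> \<tau>) (sqrt r))
        \<le> C * exp (- (sqrt r - sqrt l) * cos d') * exp (- d' * \<bar>\<tau>\<bar>)"
      using C that by simp
    also have "\<dots> \<le> \<bar>C\<bar> * 1 * exp (- d * \<bar>\<tau>\<bar>)"
      using exponent[OF that] d'(3) by (intro mult_mono) (auto simp: mult_right_mono)
    finally show ?thesis by simp
  qed
  then show "\<exists>C. \<forall>r\<in>{l..u}. \<forall>\<tau>. norm (macdonald_transform P (Complex \<alpha> \<tau>) (sqrt r)) \<le> C * exp (- d * \<bar>\<tau>\<bar>)"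
    by (intro exI ballI allI)
qed

section \<open>The squared modulus of the Macdonald function\<close>

definition K_sqrt :: "real \<Rightarrow> real \<Rightarrow> real \<Rightarrow> complex" where
  "K_sqrt \<alpha> r \<tau> = macdonald_transform (\<lambda>z. 1) (Complex \<alpha> \<tau>) (sqrt r) / 2"

text \<open>
  The Euler derivative \<open>r d/dr\<close> of \<open>K_sqrt\<close>.
\<close>

definition DK_sqrt :: "real \<Rightarrow> real \<Rightarrow> real \<Rightarrow> complex" where
  "DK_sqrt \<alpha> r \<tau> = of_real (- (sqrt r) / 4) * macdonald_transform cosh (Complex \<alpha> \<tau>) (sqrt r)"

lemma decays_exp_K_sqrt: "decays_exp (pi / 2) (K_sqrt \<alpha>)"
proof -
  have "decays_exp (pi / 2) (\<lambda>r \<tau>. (1 / 2) * macdonald_transform (\<lambda>z. 1) (Complex \<alpha> \<tau>) (sqrt r))"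
    by (rule decays_exp_coeff[OF decays_exp_of_continuous decays_exp_macdonald_transform[where P' = "\<lambda>_. 0" and B = 1 and m = 0]]) auto
  then show ?thesis
    by (simp add: K_sqrt_def[abs_def])
qed

lemma decays_exp_DK_sqrt: "decays_exp (pi / 2) (DK_sqrt \<alpha>)"
  unfolding DK_sqrt_def[abs_def]
  by (rule decays_exp_coeff[OF decays_exp_of_continuous decays_exp_macdonald_transform[where P' = sinh and B = 1 and m = 1]])
    (auto intro!: continuous_intros derivative_eq_intros norm_cosh_le_exp norm_sinh_le_exp)

lemma has_vector_derivative_K_sqrt:
  assumes "r > 0"
  shows "((\<lambda>r. K_sqrt \<alpha> r \<tau>) has_vector_derivative DK_sqrt \<alpha> r \<tau> / of_real r) (at r)"
proof -
  let ?\<mu> = "Complex \<alpha> \<tau>" and ?x = "sqrt r"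
  have "(sqrt has_vector_derivative 1 / (2 * ?x)) (at r)"
    using assms by (auto intro!: derivative_eq_intros simp: has_real_derivative_iff_has_vector_derivative[symmetric] field_simps)
  moreover have "(macdonald_transform (\<lambda>z. 1) ?\<mu> has_vector_derivative - macdonald_transform (\<lambda>z. cosh z * 1) ?\<mu> ?x) (at ?x)"
    using assms by (intro has_vector_derivative_macdonald_transform[where B = 1 and m = 0]) auto
  ultimately have "((\<lambda>r. macdonald_transform (\<lambda>z. 1) ?\<mu> (sqrt r)) has_vector_derivative
      (1 / (2 * ?x)) *\<^sub>R (- macdonald_transform cosh ?\<mu> ?x)) (at r)"
    using vector_diff_chain_at[of sqrt] by (fastforce simp: comp_def)
  then have "((\<lambda>r. macdonald_transform (\<lambda>z. 1) ?\<mu> (sqrt r) / 2) has_vector_derivative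
      (1 / (2 * ?x)) *\<^sub>R (- macdonald_transform cosh ?\<mu> ?x) / 2) (at r)"
    by (rule has_vector_derivative_divide)
  moreover have "(1 / (2 * ?x)) *\<^sub>R (- macdonald_transform cosh ?\<mu> ?x) / 2 = DK_sqrt \<alpha> r \<tau> / of_real r"
  proof -
    have "of_real r = (of_real ?x * of_real ?x :: complex)"
      using assms by (simp flip: of_real_mult)
    then show ?thesis
      using assms by (simp add: DK_sqrt_def scaleR_conv_of_real field_simps)
  qed
  ultimately show ?thesis
    by (simp add: K_sqrt_def)
qed

lemma has_vector_derivative_DK_sqrt:
  assumes "r > 0"
  shows "((\<lambda>r. DK_sqrt \<alpha> r \<tau>) has_vector_derivative
    (of_real r + (Complex \<alpha> \<tau>)\<^sup>2) * K_sqrt \<alpha> r \<tau> / (4 * of_real r)) (at r)"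
proof -
  let ?\<mu> = "Complex \<alpha> \<tau>" and ?x = "sqrt r"
  have d: "(sqrt has_real_derivative 1 / (2 * ?x)) (at r)"
    using assms by (auto intro!: derivative_eq_intros simp: field_simps)
  then have "(sqrt has_vector_derivative 1 / (2 * ?x)) (at r)"
    by (simp add: has_real_derivative_iff_has_vector_derivative)
  moreover have "(macdonald_transform cosh ?\<mu> has_vector_derivative - macdonald_transform (\<lambda>z. cosh z * cosh z) ?\<mu> ?x) (at ?x)"
    using assms by (intro has_vector_derivative_macdonald_transform[where B = 1 and m = 1])
      (auto intro!: continuous_intros norm_cosh_le_exp)
  ultimately have "((\<lambda>r. macdonald_transform cosh ?\<mu> (sqrt r)) has_vector_derivative
      (1 / (2 * ?x)) *\<^sub>R (- macdonald_transform (\<lambda>z. cosh z * cosh z) ?\<mu> ?x)) (at r)"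
    using vector_diff_chain_at[of sqrt] by (fastforce simp: comp_def)
  then have "((\<lambda>r. (- (sqrt r) / 4) *\<^sub>R macdonald_transform cosh ?\<mu> (sqrt r)) has_vector_derivative
      (- ?x / 4) *\<^sub>R ((1 / (2 * ?x)) *\<^sub>R (- macdonald_transform (\<lambda>z. cosh z * cosh z) ?\<mu> ?x))
      + (- (1 / (2 * ?x)) / 4) *\<^sub>R macdonald_transform cosh ?\<mu> ?x) (at r)"
    by (intro has_vector_derivative_scaleR DERIV_cdivide DERIV_minus d)
  moreover have "(- ?x / 4) *\<^sub>R ((1 / (2 * ?x)) *\<^sub>R (- macdonald_transform (\<lambda>z. cosh z * cosh z) ?\<mu> ?x))
      + (- (1 / (2 * ?x)) / 4) *\<^sub>R macdonald_transform cosh ?\<mu> ?x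
    = (of_real r + ?\<mu>\<^sup>2) * K_sqrt \<alpha> r \<tau> / (4 * of_real r)"
  proof -
    have r: "of_real r = (of_real ?x * of_real ?x :: complex)"
      using assms by (simp flip: of_real_mult)
    have ode: "(of_real r + ?\<mu>\<^sup>2) * K_sqrt \<alpha> r \<tau> =
      (of_real r * macdonald_transform (\<lambda>z. cosh z * cosh z) ?\<mu> ?x - of_real ?x * macdonald_transform cosh ?\<mu> ?x) / 2"
      using macdonald_transform_ode[of ?x ?\<mu>] assms by (simp add: K_sqrt_def)
    show ?thesis
      using assms unfolding ode unfolding r by (simp add: scaleR_conv_of_real field_simps)
  qed
  ultimately show ?thesis
    by (simp add: DK_sqrt_def scaleR_conv_of_real)
qed

text \<open>
  With \<open>a = K_sqrt\<close> and \<open>b = r a'\<close> the four real quantities \<open>f = \<bar>a\<bar>\<^sup>2\<close>, \<open>p = 2 Re (a cnj b)\<close>, \<open>v = Im (a cnj b)\<close>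
  and \<open>q = \<bar>b\<bar>\<^sup>2\<close> span a space closed under \<open>r d/dr\<close>, because \<open>r b' = (r + \<mu>\<^sup>2) a / 4\<close>. This first-order system
  yields all derivatives of \<open>f\<close> without further differentiation of the Macdonald integral.
\<close>

definition K_sq :: "real \<Rightarrow> real \<Rightarrow> real \<Rightarrow> real" where
  "K_sq \<alpha> r \<tau> = Re (K_sqrt \<alpha> r \<tau> * cnj (K_sqrt \<alpha> r \<tau>))"

definition K_DK_re :: "real \<Rightarrow> real \<Rightarrow> real \<Rightarrow> real" where
  "K_DK_re \<alpha> r \<tau> = 2 * Re (K_sqrt \<alpha> r \<tau> * cnj (DK_sqrt \<alpha> r \<tau>))"

definition K_DK_im :: "real \<Rightarrow> real \<Rightarrow> real \<Rightarrow> real" where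
  "K_DK_im \<alpha> r \<tau> = Im (K_sqrt \<alpha> r \<tau> * cnj (DK_sqrt \<alpha> r \<tau>))"

definition DK_sq :: "real \<Rightarrow> real \<Rightarrow> real \<Rightarrow> real" where
  "DK_sq \<alpha> r \<tau> = Re (DK_sqrt \<alpha> r \<tau> * cnj (DK_sqrt \<alpha> r \<tau>))"

lemma K_sq_eq_norm: "r > 0 \<Longrightarrow> K_sq \<alpha> r \<tau> = (norm (Macdonald_K (Complex \<alpha> \<tau>) (sqrt r)))\<^sup>2"
  unfolding K_sq_def K_sqrt_def
  by (simp only: real_sqrt_gt_0_iff Macdonald_K_eq_transform complex_mult_cnj Re_complex_of_real cmod_power2)

context
  fixes \<alpha> \<tau> r :: real
  assumes r: "r > 0"
begin

lemma
  shows DERIV_Re_K_sqrt: "((\<lambda>r. Re (K_sqrt \<alpha> r \<tau>)) has_real_derivative Re (DK_sqrt \<alpha> r \<tau>) / r) (at r)"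
    and DERIV_Im_K_sqrt: "((\<lambda>r. Im (K_sqrt \<alpha> r \<tau>)) has_real_derivative Im (DK_sqrt \<alpha> r \<tau>) / r) (at r)"
    and DERIV_Re_DK_sqrt: "((\<lambda>r. Re (DK_sqrt \<alpha> r \<tau>)) has_real_derivative
      ((r + \<alpha>\<^sup>2 - \<tau>\<^sup>2) * Re (K_sqrt \<alpha> r \<tau>) - 2 * \<alpha> * \<tau> * Im (K_sqrt \<alpha> r \<tau>)) / (4 * r)) (at r)"
    and DERIV_Im_DK_sqrt: "((\<lambda>r. Im (DK_sqrt \<alpha> r \<tau>)) has_real_derivative
      ((r + \<alpha>\<^sup>2 - \<tau>\<^sup>2) * Im (K_sqrt \<alpha> r \<tau>) + 2 * \<alpha> * \<tau> * Re (K_sqrt \<alpha> r \<tau>)) / (4 * r)) (at r)"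
proof -
  have 4: "4 * of_real r = (of_real (4 * r) :: complex)"
    by simp
  note K = has_vector_derivative_K_sqrt[OF r, of \<alpha> \<tau>] and DK = has_vector_derivative_DK_sqrt[OF r, of \<alpha> \<tau>, unfolded 4]
  show "((\<lambda>r. Re (K_sqrt \<alpha> r \<tau>)) has_real_derivative Re (DK_sqrt \<alpha> r \<tau>) / r) (at r)"
    using bounded_linear.has_vector_derivative[OF bounded_linear_Re K]
    by (simp add: has_real_derivative_iff_has_vector_derivative)
  show "((\<lambda>r. Im (K_sqrt \<alpha> r \<tau>)) has_real_derivative Im (DK_sqrt \<alpha> r \<tau>) / r) (at r)"
    using bounded_linear.has_vector_derivative[OF bounded_linear_Im K]
    by (simp add: has_real_derivative_iff_has_vector_derivative)
  show "((\<lambda>r. Re (DK_sqrt \<alpha> r \<tau>)) has_real_derivative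
      ((r + \<alpha>\<^sup>2 - \<tau>\<^sup>2) * Re (K_sqrt \<alpha> r \<tau>) - 2 * \<alpha> * \<tau> * Im (K_sqrt \<alpha> r \<tau>)) / (4 * r)) (at r)"
    using bounded_linear.has_vector_derivative[OF bounded_linear_Re DK] unfolding Re_divide_of_real
    by (simp add: has_real_derivative_iff_has_vector_derivative power2_eq_square algebra_simps)
  show "((\<lambda>r. Im (DK_sqrt \<alpha> r \<tau>)) has_real_derivative
      ((r + \<alpha>\<^sup>2 - \<tau>\<^sup>2) * Im (K_sqrt \<alpha> r \<tau>) + 2 * \<alpha> * \<tau> * Re (K_sqrt \<alpha> r \<tau>)) / (4 * r)) (at r)"
    using bounded_linear.has_vector_derivative[OF bounded_linear_Im DK] unfolding Im_divide_of_real
    by (simp add: has_real_derivative_iff_has_vector_derivative power2_eq_square algebra_simps)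
qed

lemmas DERIV_sqrt_intros [derivative_intros] =
  DERIV_Re_K_sqrt DERIV_Im_K_sqrt DERIV_Re_DK_sqrt DERIV_Im_DK_sqrt

lemma DERIV_K_sq: "((\<lambda>r. K_sq \<alpha> r \<tau>) has_real_derivative K_DK_re \<alpha> r \<tau> / r) (at r)"
  unfolding K_sq_def K_DK_re_def using r
  by (auto intro!: derivative_eq_intros simp: field_simps)

lemma DERIV_K_DK_re: "((\<lambda>r. K_DK_re \<alpha> r \<tau>) has_real_derivative
    (2 * DK_sq \<alpha> r \<tau> + (r + \<alpha>\<^sup>2 - \<tau>\<^sup>2) / 2 * K_sq \<alpha> r \<tau>) / r) (at r)"
  unfolding K_sq_def K_DK_re_def DK_sq_def using r
  by (auto intro!: derivative_eq_intros simp: field_simps)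

lemma DERIV_DK_sq: "((\<lambda>r. DK_sq \<alpha> r \<tau>) has_real_derivative
    ((r + \<alpha>\<^sup>2 - \<tau>\<^sup>2) / 4 * K_DK_re \<alpha> r \<tau> - \<alpha> * \<tau> * K_DK_im \<alpha> r \<tau>) / r) (at r)"
  unfolding K_DK_im_def K_DK_re_def DK_sq_def using r
  by (auto intro!: derivative_eq_intros simp: field_simps)

lemma DERIV_K_DK_im: "((\<lambda>r. K_DK_im \<alpha> r \<tau>) has_real_derivative - (\<alpha> * \<tau> / 2 * K_sq \<alpha> r \<tau>) / r) (at r)"
  unfolding K_DK_im_def K_sq_def using r
  by (auto intro!: derivative_eq_intros simp: field_simps)

end

lemma decays_exp_K_sq: "decays_exp pi (K_sq \<alpha>)"
  and decays_exp_K_DK_re: "decays_exp pi (K_DK_re \<alpha>)"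
  and decays_exp_K_DK_im: "decays_exp pi (K_DK_im \<alpha>)"
  and decays_exp_DK_sq: "decays_exp pi (DK_sq \<alpha>)"
proof -
  have Re: "decays_exp pi (\<lambda>r \<tau>. Re (h r \<tau> * cnj (k r \<tau>)))" and Im: "decays_exp pi (\<lambda>r \<tau>. Im (h r \<tau> * cnj (k r \<tau>)))"
    if "decays_exp (pi / 2) h" "decays_exp (pi / 2) k" for h k
  proof -
    have "decays_exp (pi / 2) (\<lambda>r \<tau>. cnj (k r \<tau>))"
      using that(2) by (rule decays_exp_compose_contraction) (auto intro: continuous_intros)
    with that(1) have *: "decays_exp (pi / 2 + pi / 2) (\<lambda>r \<tau>. h r \<tau> * cnj (k r \<tau>))"
      by (rule decays_exp_mult)
    show "decays_exp pi (\<lambda>r \<tau>. Re (h r \<tau> * cnj (k r \<tau>)))" "decays_exp pi (\<lambda>r \<tau>. Im (h r \<tau> * cnj (k r \<tau>)))"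
      using decays_exp_compose_contraction[OF *, of Re] decays_exp_compose_contraction[OF *, of Im]
      by (simp_all add: continuous_intros abs_Re_le_cmod abs_Im_le_cmod)
  qed
  show "decays_exp pi (K_sq \<alpha>)"
    unfolding K_sq_def[abs_def] by (intro Re decays_exp_K_sqrt)
  show "decays_exp pi (K_DK_re \<alpha>)"
    unfolding K_DK_re_def[abs_def]
    by (intro decays_exp_coeff decays_exp_of_continuous Re decays_exp_K_sqrt decays_exp_DK_sqrt) simp
  show "decays_exp pi (K_DK_im \<alpha>)"
    unfolding K_DK_im_def[abs_def] by (intro Im decays_exp_K_sqrt decays_exp_DK_sqrt)
  show "decays_exp pi (DK_sq \<alpha>)"
    unfolding DK_sq_def[abs_def] by (intro Re decays_exp_DK_sqrt)
qed

text \<open>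
  The \<open>n\<close>-th entry is \<open>N\<^sub>n = r\<^sup>n f\<^sup>(\<^sup>n\<^sup>)\<close>. It follows from the first-order system by the recursion
  \<open>N\<^sub>n\<^sub>+\<^sub>1 = r N\<^sub>n' - n N\<^sub>n\<close>.
\<close>

definition K_sq_numerators :: "real \<Rightarrow> real \<Rightarrow> real \<Rightarrow> real list" where
  "K_sq_numerators \<alpha> r \<tau> =
    (let f = K_sq \<alpha> r \<tau>; p = K_DK_re \<alpha> r \<tau>; q = DK_sq \<alpha> r \<tau>; v = K_DK_im \<alpha> r \<tau>; \<delta> = \<alpha>\<^sup>2 - \<tau>\<^sup>2 in
     [f,
      p,
      2 * q + (r + \<delta>) / 2 * f - p,
      (r + \<delta> + 2) * p - 2 * \<alpha> * \<tau> * v - (r + 3 / 2 * \<delta>) * f - 6 * q,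
      - (9 / 2 * r + 6 * \<delta> + 6) * p + (2 * (r + \<delta>) + 22) * q + 12 * \<alpha> * \<tau> * v
        + ((r + \<delta>)\<^sup>2 / 2 + 3 * r + 11 / 2 * \<delta> + \<alpha>\<^sup>2 * \<tau>\<^sup>2) * f])"

definition K_sq_deriv :: "nat \<Rightarrow> real \<Rightarrow> real \<Rightarrow> real \<Rightarrow> real" where
  "K_sq_deriv n \<alpha> r \<tau> = K_sq_numerators \<alpha> r \<tau> ! n / r ^ n"

lemma DERIV_quotient_power:
  assumes N: "(N has_real_derivative N' / r) (at r)" and r: "r > 0"
  shows "((\<lambda>r. N r / r ^ n) has_real_derivative (N' - real n * N r) / r ^ Suc n) (at r)"
proof -
  have "((\<lambda>r. N r / r ^ n) has_real_derivative (N' / r * r ^ n - N r * (real n * r ^ (n - Suc 0))) / (r ^ n * r ^ n)) (at r)"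
    using r by (auto intro!: derivative_eq_intros N)
  moreover have "real n * r ^ (n - Suc 0) = real n * r ^ n / r"
    using r by (cases n) auto
  then have "(N' / r * r ^ n - N r * (real n * r ^ (n - Suc 0))) / (r ^ n * r ^ n) = (N' - real n * N r) / r ^ Suc n"
    using r by (simp only:) (simp add: field_simps)
  ultimately show ?thesis
    by simp
qed

lemma DERIV_K_sq_deriv:
  assumes r: "r > 0" and n: "n < 4"
  shows "((\<lambda>r. K_sq_deriv n \<alpha> r \<tau>) has_real_derivative K_sq_deriv (Suc n) \<alpha> r \<tau>) (at r)"
proof -
  note D = DERIV_K_sq[OF r] DERIV_K_DK_re[OF r] DERIV_DK_sq[OF r] DERIV_K_DK_im[OF r]
  let ?N = "K_sq_numerators \<alpha> r \<tau>"
  have "((\<lambda>r. K_sq_numerators \<alpha> r \<tau> ! n) has_real_derivative (?N ! Suc n + real n * ?N ! n) / r) (at r)"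
  proof -
    consider "n = 0" | "n = 1" | "n = 2" | "n = 3"
      using n by linarith
    then show ?thesis
    proof cases
      case 1
      then show ?thesis
        using D(1) by (simp add: K_sq_numerators_def Let_def)
    next
      case 2
      then show ?thesis
        using D(2) by (simp add: K_sq_numerators_def Let_def add_diff_eq)
    qed (use r in \<open>unfold K_sq_numerators_def Let_def,
      auto intro!: derivative_eq_intros D simp: field_simps power2_eq_square\<close>)
  qed
  from DERIV_quotient_power[OF this r, of n] show ?thesis
    by (simp add: K_sq_deriv_def)
qed

text \<open>
  This is the separated form of the partial differential equation, \<open>\<partial>\<^sup>2/\<partial>\<theta>\<^sup>2\<close> having become \<open>\<tau>\<^sup>2\<close>.
  Multiplied by \<open>r\<close>, it is a polynomial identity between the numerators.
\<close>

lemma K_sq_ode: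
  assumes r: "r > 0"
  shows "r ^ 3 * K_sq_deriv 4 \<alpha> r \<tau> + r * (\<tau>\<^sup>2 * K_sq_deriv 2 \<alpha> r \<tau>) + (6 * r\<^sup>2) * K_sq_deriv 3 \<alpha> r \<tau>
    + \<tau>\<^sup>2 * K_sq_deriv 1 \<alpha> r \<tau> + (r * (7 - \<alpha>\<^sup>2 - r)) * K_sq_deriv 2 \<alpha> r \<tau> - (\<alpha>\<^sup>2 / r) * (\<tau>\<^sup>2 * K_sq_deriv 0 \<alpha> r \<tau>)
    + (1 - \<alpha>\<^sup>2 - 5 / 2 * r) * K_sq_deriv 1 \<alpha> r \<tau> - (1 / 2) * K_sq_deriv 0 \<alpha> r \<tau> = 0" (is "?lhs = 0")
proof -
  let ?N = "\<lambda>n. K_sq_numerators \<alpha> r \<tau> ! n"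
  have "?N 4 + \<tau>\<^sup>2 * ?N 2 + 6 * ?N 3 + \<tau>\<^sup>2 * ?N 1 + (7 - \<alpha>\<^sup>2 - r) * ?N 2 - \<alpha>\<^sup>2 * \<tau>\<^sup>2 * ?N 0
      + (1 - \<alpha>\<^sup>2 - 5 / 2 * r) * ?N 1 - r / 2 * ?N 0 = 0"
    by (simp add: K_sq_numerators_def Let_def field_simps power2_eq_square)
  moreover have "r * ?lhs = ?N 4 + \<tau>\<^sup>2 * ?N 2 + 6 * ?N 3 + \<tau>\<^sup>2 * ?N 1 + (7 - \<alpha>\<^sup>2 - r) * ?N 2 - \<alpha>\<^sup>2 * \<tau>\<^sup>2 * ?N 0
      + (1 - \<alpha>\<^sup>2 - 5 / 2 * r) * ?N 1 - r / 2 * ?N 0"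
    using r unfolding K_sq_deriv_def by (simp add: field_simps power2_eq_square power3_eq_cube power4_eq_xxxx)
  ultimately have "r * ?lhs = 0"
    by (simp only:)
  then show ?thesis
    using r by (auto simp only: mult_eq_0_iff less_irrefl)
qed

lemma decays_exp_K_sq_deriv:
  assumes n: "n \<le> 4"
  shows "decays_exp pi (K_sq_deriv n \<alpha>)"
proof -
  have const: "decays_exp 0 (\<lambda>_ _. c)" for c :: real
    by (intro decays_exp_of_continuous) simp
  have id: "decays_exp 0 (\<lambda>r _. r)"
    by (intro decays_exp_of_continuous) simp
  have divide: "decays_exp D (\<lambda>r \<tau>. h r \<tau> / c)" if "decays_exp D h" for h :: "real \<Rightarrow> real \<Rightarrow> real" and c D
    using decays_exp_coeff[OF const that, of "1 / c"] by simp
  note rules = divide decays_exp_add decays_exp_diff decays_exp_uminus decays_exp_coeff decays_exp_power decays_exp_tau const id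
    decays_exp_K_sq decays_exp_K_DK_re decays_exp_K_DK_im decays_exp_DK_sq
  consider "n = 0" | "n = 1" | "n = 2" | "n = 3" | "n = 4"
    using n by linarith
  then have "decays_exp pi (\<lambda>r \<tau>. K_sq_numerators \<alpha> r \<tau> ! n)"
    by cases (simp add: K_sq_numerators_def Let_def; intro rules)+
  then have "decays_exp pi (\<lambda>r \<tau>. inverse (r ^ n) * K_sq_numerators \<alpha> r \<tau> ! n)"
    by (intro decays_exp_coeff decays_exp_of_continuous) (auto intro!: continuous_intros)
  then show ?thesis
    by (simp add: K_sq_deriv_def[abs_def] divide_inverse mult.commute)
qed

section \<open>Integration against a weighted integrable function\<close>

context
  fixes \<beta> :: real and g :: "real \<Rightarrow> complex"
  assumes g: "g \<in> weighted_L1 (\<lambda>\<tau>. exp ((\<beta> - pi) * \<bar>\<tau>\<bar>))"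
begin

definition wedge_transform :: "(real \<Rightarrow> real \<Rightarrow> real) \<Rightarrow> real \<Rightarrow> real \<Rightarrow> complex" where
  "wedge_transform h r \<theta> = (\<integral>\<tau>. (exp (\<theta> * \<tau>) * h r \<tau>) *\<^sub>R g \<tau> \<partial>lebesgue)"

lemma measurable_g: "g \<in> borel_measurable lebesgue"
  and integrable_g: "integrable lebesgue (\<lambda>\<tau>. norm (g \<tau>) * exp ((\<beta> - pi) * \<bar>\<tau>\<bar>))"
  using g by (auto simp: weighted_L1_def)

lemma measurable_wedge_integrand:
  assumes "decays_exp D h" "r > 0"
  shows "(\<lambda>\<tau>. (exp (\<theta> * \<tau>) * h r \<tau>) *\<^sub>R g \<tau>) \<in> borel_measurable lebesgue"
proof -
  have [measurable]: "h r \<in> borel_measurable borel"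
    by (rule decays_exp_measurable[OF assms])
  have "(\<lambda>\<tau>. exp (\<theta> * \<tau>) * h r \<tau>) \<in> borel_measurable lebesgue"
    by (rule measurable_completion) measurable
  then show ?thesis
    using measurable_g by (rule borel_measurable_scaleR)
qed

text \<open>
  For angles up to \<open>t < \<beta>\<close> the kernel is used at the rate \<open>t + \<pi> - \<beta>\<close>, which is below \<open>\<pi>\<close> exactly because
  \<open>t < \<beta>\<close>: the factor \<open>exp (t \<bar>\<tau>\<bar>)\<close> is then brought down to the weight \<open>exp ((\<beta> - \<pi>) \<bar>\<tau>\<bar>)\<close>.
\<close>

lemma norm_wedge_integrand_le:
  assumes h: "decays_exp pi h" and l: "l > 0" and t: "t < \<beta>"
  shows "\<exists>C. \<forall>r\<in>{l..u}. \<forall>\<theta>\<in>{0..t}. \<forall>\<tau>.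
    norm ((exp (\<theta> * \<tau>) * h r \<tau>) *\<^sub>R g \<tau>) \<le> C * (norm (g \<tau>) * exp ((\<beta> - pi) * \<bar>\<tau>\<bar>))"
proof -
  have d: "t + pi - \<beta> < pi"
    using t by simp
  obtain C where C: "\<forall>r\<in>{l..u}. \<forall>\<tau>. norm (h r \<tau>) \<le> C * exp (- (t + pi - \<beta>) * \<bar>\<tau>\<bar>)"
    using decays_expD[OF h d l, where u = u] ..
  have "norm ((exp (\<theta> * \<tau>) * h r \<tau>) *\<^sub>R g \<tau>) \<le> C * (norm (g \<tau>) * exp ((\<beta> - pi) * \<bar>\<tau>\<bar>))"
    if r: "r \<in> {l..u}" and \<theta>: "\<theta> \<in> {0..t}" for r \<theta> \<tau>
  proof -
    have "\<theta> * \<tau> \<le> \<theta> * \<bar>\<tau>\<bar>" "\<theta> * \<bar>\<tau>\<bar> \<le> t * \<bar>\<tau>\<bar>"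
      using \<theta> by (auto intro: mult_left_mono mult_right_mono)
    then have "exp (\<theta> * \<tau>) \<le> exp (t * \<bar>\<tau>\<bar>)"
      by simp
    then have "exp (\<theta> * \<tau>) * norm (h r \<tau>) \<le> exp (t * \<bar>\<tau>\<bar>) * (C * exp (- (t + pi - \<beta>) * \<bar>\<tau>\<bar>))"
      using C r by (intro mult_mono) auto
    also have "\<dots> = C * exp ((\<beta> - pi) * \<bar>\<tau>\<bar>)"
      by (simp add: exp_add[symmetric] algebra_simps)
    finally have "exp (\<theta> * \<tau>) * norm (h r \<tau>) \<le> C * exp ((\<beta> - pi) * \<bar>\<tau>\<bar>)" .
    from mult_right_mono[OF this norm_ge_zero[of "g \<tau>"]] show ?thesis
      by (simp add: abs_mult mult_ac)
  qed
  then show ?thesis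
    by (intro exI ballI allI)
qed

lemma integrable_wedge_integrand:
  assumes h: "decays_exp pi h" and r: "r > 0" and \<theta>: "\<theta> \<in> {0..<\<beta>}"
  shows "integrable lebesgue (\<lambda>\<tau>. (exp (\<theta> * \<tau>) * h r \<tau>) *\<^sub>R g \<tau>)"
proof -
  obtain C where C: "\<forall>r\<in>{r..r}. \<forall>\<theta>'\<in>{0..\<theta>}. \<forall>\<tau>.
      norm ((exp (\<theta>' * \<tau>) * h r \<tau>) *\<^sub>R g \<tau>) \<le> C * (norm (g \<tau>) * exp ((\<beta> - pi) * \<bar>\<tau>\<bar>))"
    using norm_wedge_integrand_le[OF h r, of \<theta> r] \<theta> by auto
  show ?thesis
  proof (rule Bochner_Integration.integrable_bound)
    show "integrable lebesgue (\<lambda>\<tau>. C * (norm (g \<tau>) * exp ((\<beta> - pi) * \<bar>\<tau>\<bar>)))"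
      using integrable_g by simp
    show "AE \<tau> in lebesgue. norm ((exp (\<theta> * \<tau>) * h r \<tau>) *\<^sub>R g \<tau>) \<le> norm (C * (norm (g \<tau>) * exp ((\<beta> - pi) * \<bar>\<tau>\<bar>)))"
    proof (rule AE_I2)
      fix \<tau>
      have "norm ((exp (\<theta> * \<tau>) * h r \<tau>) *\<^sub>R g \<tau>) \<le> C * (norm (g \<tau>) * exp ((\<beta> - pi) * \<bar>\<tau>\<bar>))"
        using C \<theta> by simp
      then show "norm ((exp (\<theta> * \<tau>) * h r \<tau>) *\<^sub>R g \<tau>) \<le> norm (C * (norm (g \<tau>) * exp ((\<beta> - pi) * \<bar>\<tau>\<bar>)))"
        by (rule order_trans) simp
    qed
  qed (rule measurable_wedge_integrand[OF h r])
qed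

lemma has_vector_derivative_wedge_transform_r:
  assumes h: "decays_exp pi h" and h': "decays_exp pi h'" and r: "r > 0" and \<theta>: "\<theta> \<in> {0..<\<beta>}"
    and der: "\<And>r \<tau>. r > 0 \<Longrightarrow> ((\<lambda>r. h r \<tau>) has_real_derivative h' r \<tau>) (at r)"
  shows "((\<lambda>r. wedge_transform h r \<theta>) has_vector_derivative wedge_transform h' r \<theta>) (at r)"
proof -
  let ?S = "{r / 2<..<2 * r}"
  obtain C where C: "\<forall>s\<in>{r / 2..2 * r}. \<forall>\<theta>'\<in>{0..\<theta>}. \<forall>\<tau>.
      norm ((exp (\<theta>' * \<tau>) * h' s \<tau>) *\<^sub>R g \<tau>) \<le> C * (norm (g \<tau>) * exp ((\<beta> - pi) * \<bar>\<tau>\<bar>))"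
    using norm_wedge_integrand_le[OF h', of "r / 2" \<theta> "2 * r"] \<theta> r by auto
  have "((\<lambda>r. wedge_transform h r \<theta>) has_vector_derivative wedge_transform h' r \<theta>) (at r within ?S)"
    unfolding wedge_transform_def
  proof (rule has_vector_derivative_integral_dominated)
    show "integrable lebesgue (\<lambda>\<tau>. (exp (\<theta> * \<tau>) * h s \<tau>) *\<^sub>R g \<tau>)" if "s \<in> ?S" for s
      using that r \<theta> by (intro integrable_wedge_integrand h) auto
    show "((\<lambda>s. (exp (\<theta> * \<tau>) * h s \<tau>) *\<^sub>R g \<tau>) has_vector_derivative (exp (\<theta> * \<tau>) * h' s \<tau>) *\<^sub>R g \<tau>) (at s within ?S)"
      if "s \<in> ?S" for s \<tau>
    proof -
      have "((\<lambda>s. exp (\<theta> * \<tau>) * h s \<tau>) has_real_derivative exp (\<theta> * \<tau>) * h' s \<tau>) (at s)"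
        using that r by (intro DERIV_cmult der) auto
      from has_vector_derivative_scaleR[OF this has_vector_derivative_const[of "g \<tau>"]] show ?thesis
        by (simp add: has_vector_derivative_at_within)
    qed
    show "norm ((exp (\<theta> * \<tau>) * h' s \<tau>) *\<^sub>R g \<tau>) \<le> C * (norm (g \<tau>) * exp ((\<beta> - pi) * \<bar>\<tau>\<bar>))" if "s \<in> ?S" for s \<tau>
      using C that \<theta> by simp
    show "integrable lebesgue (\<lambda>\<tau>. C * (norm (g \<tau>) * exp ((\<beta> - pi) * \<bar>\<tau>\<bar>)))"
      using integrable_g by simp
  qed (use r measurable_wedge_integrand[OF h' r] in auto)
  then show ?thesis
    using r by (simp add: at_within_open[of r ?S])
qed

text \<open>
  The domination is uniform only up to an angle below \<open>\<beta>\<close>, so the wedge is first cut down to the midpoint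
  between \<open>\<theta>\<close> and \<open>\<beta>\<close>, which does not affect derivatives at \<open>\<theta>\<close>.
\<close>

lemma has_vector_derivative_wedge_transform_theta:
  assumes h: "decays_exp pi h" and r: "r > 0" and \<theta>: "\<theta> \<in> {0..<\<beta>}"
  shows "((\<lambda>\<theta>. wedge_transform h r \<theta>) has_vector_derivative wedge_transform (\<lambda>r \<tau>. \<tau> * h r \<tau>) r \<theta>) (at \<theta> within {0..<\<beta>})"
proof -
  define t where "t = (\<theta> + \<beta>) / 2"
  have t: "\<theta> < t" "t < \<beta>"
    using \<theta> by (auto simp: t_def)
  have h': "decays_exp pi (\<lambda>r \<tau>. \<tau> * h r \<tau>)"
    by (intro decays_exp_coeff decays_exp_tau h)
  let ?S = "{0..<t}"
  obtain C where C: "\<forall>s\<in>{r..r}. \<forall>\<theta>'\<in>{0..t}. \<forall>\<tau>.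
      norm ((exp (\<theta>' * \<tau>) * (\<tau> * h s \<tau>)) *\<^sub>R g \<tau>) \<le> C * (norm (g \<tau>) * exp ((\<beta> - pi) * \<bar>\<tau>\<bar>))"
    using norm_wedge_integrand_le[OF h' r t(2), of r] by auto
  have "((\<lambda>\<theta>. wedge_transform h r \<theta>) has_vector_derivative wedge_transform (\<lambda>r \<tau>. \<tau> * h r \<tau>) r \<theta>) (at \<theta> within ?S)"
    unfolding wedge_transform_def
  proof (rule has_vector_derivative_integral_dominated)
    show "integrable lebesgue (\<lambda>\<tau>. (exp (y * \<tau>) * h r \<tau>) *\<^sub>R g \<tau>)" if "y \<in> ?S" for y
      using that r t by (intro integrable_wedge_integrand h) auto
    show "((\<lambda>y. (exp (y * \<tau>) * h r \<tau>) *\<^sub>R g \<tau>) has_vector_derivative (exp (y * \<tau>) * (\<tau> * h r \<tau>)) *\<^sub>R g \<tau>) (at y within ?S)"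
      for y \<tau>
    proof -
      have "((\<lambda>y. exp (y * \<tau>) * h r \<tau>) has_real_derivative exp (y * \<tau>) * (\<tau> * h r \<tau>)) (at y within ?S)"
        by (auto intro!: derivative_eq_intros)
      from has_vector_derivative_scaleR[OF this has_vector_derivative_const[of "g \<tau>"]] show ?thesis
        by simp
    qed
    show "norm ((exp (y * \<tau>) * (\<tau> * h r \<tau>)) *\<^sub>R g \<tau>) \<le> C * (norm (g \<tau>) * exp ((\<beta> - pi) * \<bar>\<tau>\<bar>))" if "y \<in> ?S" for y \<tau>
      using C that by simp
    show "integrable lebesgue (\<lambda>\<tau>. C * (norm (g \<tau>) * exp ((\<beta> - pi) * \<bar>\<tau>\<bar>)))"
      using integrable_g by simp
  qed (use \<theta> t measurable_wedge_integrand[OF h' r] in auto)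
  moreover have "at \<theta> within ?S = at \<theta> within {0..<\<beta>}"
    by (rule at_within_nhd[of _ "{..<t}"]) (use t in auto)
  ultimately show ?thesis
    by simp
qed

lemma Psi_integrand_eq:
  "r > 0 \<Longrightarrow> Psi_integrand \<alpha> g r \<theta> = (\<lambda>\<tau>. (exp (\<theta> * \<tau>) * K_sq_deriv 0 \<alpha> r \<tau>) *\<^sub>R g \<tau>)"
  by (rule ext) (simp add: Psi_integrand_def K_sq_deriv_def K_sq_numerators_def Let_def K_sq_eq_norm)

lemma Psi_eq: "r > 0 \<Longrightarrow> Psi \<alpha> g r \<theta> = wedge_transform (K_sq_deriv 0 \<alpha>) r \<theta>"
  by (simp add: Psi_def Psi_integrand_eq wedge_transform_def)

lemma integrable_Psi_integrand:
  "r > 0 \<Longrightarrow> \<theta> \<in> {0..<\<beta>} \<Longrightarrow> integrable lebesgue (Psi_integrand \<alpha> g r \<theta>)"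
  unfolding Psi_integrand_eq by (intro integrable_wedge_integrand decays_exp_K_sq_deriv) auto

lemma wedge_transform_K_sq_pde:
  assumes r: "r > 0" and \<theta>: "\<theta> \<in> {0..<\<beta>}"
  defines "T \<equiv> \<lambda>h. wedge_transform h r \<theta>"
  shows "r ^ 3 *\<^sub>R T (K_sq_deriv 4 \<alpha>) + r *\<^sub>R T (\<lambda>r \<tau>. \<tau>\<^sup>2 * K_sq_deriv 2 \<alpha> r \<tau>) + (6 * r\<^sup>2) *\<^sub>R T (K_sq_deriv 3 \<alpha>)
    + T (\<lambda>r \<tau>. \<tau>\<^sup>2 * K_sq_deriv 1 \<alpha> r \<tau>) + (r * (7 - \<alpha>\<^sup>2 - r)) *\<^sub>R T (K_sq_deriv 2 \<alpha>)
    - (\<alpha>\<^sup>2 / r) *\<^sub>R T (\<lambda>r \<tau>. \<tau>\<^sup>2 * K_sq_deriv 0 \<alpha> r \<tau>)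
    + (1 - \<alpha>\<^sup>2 - 5 / 2 * r) *\<^sub>R T (K_sq_deriv 1 \<alpha>) - (1 / 2) *\<^sub>R T (K_sq_deriv 0 \<alpha>) = 0" (is "?lhs = 0")
proof -
  define \<Phi> where "\<Phi> h \<tau> = (exp (\<theta> * \<tau>) * h r \<tau>) *\<^sub>R g \<tau>" for h :: "real \<Rightarrow> real \<Rightarrow> real" and \<tau>
  have int: "integrable lebesgue (\<Phi> (K_sq_deriv n \<alpha>))"
    "integrable lebesgue (\<Phi> (\<lambda>r \<tau>. \<tau>\<^sup>2 * K_sq_deriv n \<alpha> r \<tau>))" if "n \<le> 4" for n
    unfolding \<Phi>_def using that r \<theta>
    by (intro integrable_wedge_integrand decays_exp_coeff decays_exp_power decays_exp_tau decays_exp_K_sq_deriv; simp)+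
  have "?lhs = (\<integral>\<tau>. r ^ 3 *\<^sub>R \<Phi> (K_sq_deriv 4 \<alpha>) \<tau> + r *\<^sub>R \<Phi> (\<lambda>r \<tau>. \<tau>\<^sup>2 * K_sq_deriv 2 \<alpha> r \<tau>) \<tau> + (6 * r\<^sup>2) *\<^sub>R \<Phi> (K_sq_deriv 3 \<alpha>) \<tau>
    + \<Phi> (\<lambda>r \<tau>. \<tau>\<^sup>2 * K_sq_deriv 1 \<alpha> r \<tau>) \<tau> + (r * (7 - \<alpha>\<^sup>2 - r)) *\<^sub>R \<Phi> (K_sq_deriv 2 \<alpha>) \<tau>
    - (\<alpha>\<^sup>2 / r) *\<^sub>R \<Phi> (\<lambda>r \<tau>. \<tau>\<^sup>2 * K_sq_deriv 0 \<alpha> r \<tau>) \<tau>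
    + (1 - \<alpha>\<^sup>2 - 5 / 2 * r) *\<^sub>R \<Phi> (K_sq_deriv 1 \<alpha>) \<tau> - (1 / 2) *\<^sub>R \<Phi> (K_sq_deriv 0 \<alpha>) \<tau> \<partial>lebesgue)"
    unfolding T_def wedge_transform_def \<Phi>_def[symmetric]
    by (simp add: int)
  also have "\<dots> = 0"
  proof -
    define w where "w \<tau> = exp (\<theta> * \<tau>) *\<^sub>R g \<tau>" for \<tau>
    have lin: "\<Phi> h \<tau> = h r \<tau> *\<^sub>R w \<tau>" for h \<tau>
      by (simp add: \<Phi>_def w_def mult.commute)
    have "r ^ 3 *\<^sub>R \<Phi> (K_sq_deriv 4 \<alpha>) \<tau> + r *\<^sub>R \<Phi> (\<lambda>r \<tau>. \<tau>\<^sup>2 * K_sq_deriv 2 \<alpha> r \<tau>) \<tau> + (6 * r\<^sup>2) *\<^sub>R \<Phi> (K_sq_deriv 3 \<alpha>) \<tau>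
      + \<Phi> (\<lambda>r \<tau>. \<tau>\<^sup>2 * K_sq_deriv 1 \<alpha> r \<tau>) \<tau> + (r * (7 - \<alpha>\<^sup>2 - r)) *\<^sub>R \<Phi> (K_sq_deriv 2 \<alpha>) \<tau>
      - (\<alpha>\<^sup>2 / r) *\<^sub>R \<Phi> (\<lambda>r \<tau>. \<tau>\<^sup>2 * K_sq_deriv 0 \<alpha> r \<tau>) \<tau>
      + (1 - \<alpha>\<^sup>2 - 5 / 2 * r) *\<^sub>R \<Phi> (K_sq_deriv 1 \<alpha>) \<tau> - (1 / 2) *\<^sub>R \<Phi> (K_sq_deriv 0 \<alpha>) \<tau> = 0" for \<tau>
      unfolding lin scaleR_scaleR scaleR_add_left[symmetric] scaleR_diff_left[symmetric] K_sq_ode[OF r] by simp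
    then show ?thesis
      by simp
  qed
  finally show ?thesis .
qed

text \<open>
  Each derivative in \<open>r\<close> falls on the kernel and each derivative in \<open>\<theta>\<close> brings down a factor \<open>\<tau>\<close>, so all
  required derivatives are transforms of \<open>\<tau>\<^sup>k f\<^sup>(\<^sup>n\<^sup>)\<close>.
\<close>

lemma Psi_solves_wedge_pde: "solves_wedge_pde \<alpha> \<beta> (Psi \<alpha> g)"
proof -
  let ?T = "wedge_transform"
  let ?f = "\<lambda>n. K_sq_deriv n \<alpha>"
  have decay: "decays_exp pi (\<lambda>r \<tau>. \<tau> ^ k * ?f n r \<tau>)" if "n \<le> 4" for k n
    using that by (intro decays_exp_coeff decays_exp_power decays_exp_tau decays_exp_K_sq_deriv)
  have dr: "((\<lambda>s. ?T (\<lambda>r \<tau>. \<tau> ^ k * ?f n r \<tau>) s \<theta>) has_vector_derivative ?T (\<lambda>r \<tau>. \<tau> ^ k * ?f (Suc n) r \<tau>) r \<theta>) (at r)"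
    if "n < 4" "r > 0" "\<theta> \<in> {0..<\<beta>}" for k n r \<theta>
    using that by (intro has_vector_derivative_wedge_transform_r decay DERIV_cmult DERIV_K_sq_deriv) auto
  have dt: "((\<lambda>t. ?T (\<lambda>r \<tau>. \<tau> ^ k * ?f 0 r \<tau>) r t) has_vector_derivative ?T (\<lambda>r \<tau>. \<tau> ^ Suc k * ?f 0 r \<tau>) r \<theta>)
      (at \<theta> within {0..<\<beta>})" if "r > 0" "\<theta> \<in> {0..<\<beta>}" for k r \<theta>
    using has_vector_derivative_wedge_transform_theta[OF decay[of 0 k] that] by (simp add: mult.assoc)
  have Psi_r: "((\<lambda>s. Psi \<alpha> g s \<theta>) has_vector_derivative ?T (?f 1) r \<theta>) (at r)" if "r > 0" "\<theta> \<in> {0..<\<beta>}" for r \<theta>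
  proof (rule has_vector_derivative_transform_within_open[of _ _ _ "{0<..}"])
    show "((\<lambda>s. ?T (?f 0) s \<theta>) has_vector_derivative ?T (?f 1) r \<theta>) (at r)"
      using dr[of 0 r \<theta> 0] that by simp
  qed (use that Psi_eq in auto)
  have Psi_t: "((\<lambda>t. Psi \<alpha> g r t) has_vector_derivative ?T (\<lambda>r \<tau>. \<tau> * ?f 0 r \<tau>) r \<theta>) (at \<theta> within {0..<\<beta>})"
    if "r > 0" "\<theta> \<in> {0..<\<beta>}" for r \<theta>
    using dt[of r \<theta> 0] that by (simp add: Psi_eq)
  have pde: "r ^ 3 *\<^sub>R ?T (?f 4) r \<theta> + r *\<^sub>R ?T (\<lambda>r \<tau>. \<tau>\<^sup>2 * ?f 2 r \<tau>) r \<theta> + (6 * r\<^sup>2) *\<^sub>R ?T (?f 3) r \<theta>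
    + ?T (\<lambda>r \<tau>. \<tau>\<^sup>2 * ?f 1 r \<tau>) r \<theta> + (r * (7 - \<alpha>\<^sup>2 - r)) *\<^sub>R ?T (?f 2) r \<theta>
    - (\<alpha>\<^sup>2 / r) *\<^sub>R ?T (\<lambda>r \<tau>. \<tau>\<^sup>2 * ?f 0 r \<tau>) r \<theta>
    + (1 - \<alpha>\<^sup>2 - 5 / 2 * r) *\<^sub>R ?T (?f 1) r \<theta> - (1 / 2) *\<^sub>R Psi \<alpha> g r \<theta> = 0" if "r > 0" "\<theta> \<in> {0..<\<beta>}" for r \<theta>
    unfolding Psi_eq[OF that(1)] using that by (rule wedge_transform_K_sq_pde)
  show ?thesis
    unfolding solves_wedge_pde_def
    by (rule exI[of _ "?T (?f 1)"], rule exI[of _ "?T (?f 2)"], rule exI[of _ "?T (?f 3)"], rule exI[of _ "?T (?f 4)"],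
        rule exI[of _ "?T (\<lambda>r \<tau>. \<tau> * ?f 0 r \<tau>)"], rule exI[of _ "?T (\<lambda>r \<tau>. \<tau>\<^sup>2 * ?f 0 r \<tau>)"],
        rule exI[of _ "?T (\<lambda>r \<tau>. \<tau>\<^sup>2 * ?f 1 r \<tau>)"], rule exI[of _ "?T (\<lambda>r \<tau>. \<tau>\<^sup>2 * ?f 2 r \<tau>)"])
      (use Psi_r Psi_t dr[of 1 _ _ 0] dr[of 2 _ _ 0] dr[of 3 _ _ 0] dt[of _ _ 1] dr[of 0 _ _ 2] dr[of 1 _ _ 2]
        pde in \<open>simp add: numeral_2_eq_2[symmetric]\<close>)
qed

text \<open>
  A local bound does not suffice here. The bound of the Macdonald integral that is global in \<open>x \<ge> 1\<close> gives,
  besides the decay in \<open>\<tau>\<close>, a factor \<open>exp (- 2 (\<surd>r - 1) cos d)\<close> common to all \<open>\<tau>\<close>.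
\<close>

lemma Psi_tendsto_0:
  assumes \<theta>: "\<theta> \<in> {0..<\<beta>}"
  shows "((\<lambda>r. Psi \<alpha> g r \<theta>) \<longlongrightarrow> 0) at_top"
proof -
  \<comment> \<open>\<open>2 d\<close> is the rate that turns \<open>exp (\<theta> \<bar>\<tau>\<bar>)\<close> into at most the weight; it is below \<open>\<pi>\<close> since \<open>\<theta> < \<beta>\<close>.\<close>
  define d where "d = max 0 ((\<theta> + pi - \<beta>) / 2)"
  have d: "0 \<le> d" "d < pi / 2" "\<theta> - 2 * d \<le> \<beta> - pi"
    using \<theta> by (auto simp: d_def max_def field_simps)
  have cos: "cos d > 0"
    using d by (intro cos_gt_zero_pi) auto
  obtain C where C: "\<forall>x\<ge>1. \<forall>\<tau>. norm (macdonald_transform (\<lambda>z. 1) (Complex \<alpha> \<tau>) x) \<le> C * exp (- (x - 1) * cos d) * exp (- d * \<bar>\<tau>\<bar>)"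
    using macdonald_transform_bound[of "\<lambda>_. 1" "\<lambda>_. 0" 1 0 d 1 \<alpha>] d by auto
  define G where "G = (\<integral>\<tau>. norm (g \<tau>) * exp ((\<beta> - pi) * \<bar>\<tau>\<bar>) \<partial>lebesgue)"
  have bound: "norm (Psi \<alpha> g r \<theta>) \<le> (C / 2)\<^sup>2 * exp (- 2 * (sqrt r - 1) * cos d) * G" if r: "r \<ge> 1" for r
  proof -
    have "norm (Psi \<alpha> g r \<theta>) \<le> (\<integral>\<tau>. ((C / 2)\<^sup>2 * exp (- 2 * (sqrt r - 1) * cos d)) * (norm (g \<tau>) * exp ((\<beta> - pi) * \<bar>\<tau>\<bar>)) \<partial>lebesgue)"
      unfolding Psi_def
    proof (rule Bochner_Integration.integral_norm_bound_integral)
      show "integrable lebesgue (Psi_integrand \<alpha> g r \<theta>)"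
        using r \<theta> by (intro integrable_Psi_integrand) auto
      fix \<tau>
      have "norm (Macdonald_K (Complex \<alpha> \<tau>) (sqrt r)) \<le> (C / 2) * exp (- (sqrt r - 1) * cos d) * exp (- d * \<bar>\<tau>\<bar>)"
        using C r by (simp add: Macdonald_K_eq_transform norm_divide field_simps)
      then have "(norm (Macdonald_K (Complex \<alpha> \<tau>) (sqrt r)))\<^sup>2 \<le> ((C / 2) * exp (- (sqrt r - 1) * cos d) * exp (- d * \<bar>\<tau>\<bar>))\<^sup>2"
        by (intro power_mono) auto
      also have "\<dots> = (C / 2)\<^sup>2 * exp (- 2 * (sqrt r - 1) * cos d) * exp (- 2 * d * \<bar>\<tau>\<bar>)"
        unfolding power_mult_distrib exp_double[symmetric] by (simp add: mult.assoc)
      finally have K: "(norm (Macdonald_K (Complex \<alpha> \<tau>) (sqrt r)))\<^sup>2 \<le>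
        (C / 2)\<^sup>2 * exp (- 2 * (sqrt r - 1) * cos d) * exp (- 2 * d * \<bar>\<tau>\<bar>)" .
      have "\<theta> * \<tau> - 2 * d * \<bar>\<tau>\<bar> \<le> (\<theta> - 2 * d) * \<bar>\<tau>\<bar>"
        using \<theta> by (simp add: left_diff_distrib mult_left_mono)
      also have "\<dots> \<le> (\<beta> - pi) * \<bar>\<tau>\<bar>"
        using d(3) by (rule mult_right_mono) simp
      finally have "exp (\<theta> * \<tau>) * exp (- 2 * d * \<bar>\<tau>\<bar>) \<le> exp ((\<beta> - pi) * \<bar>\<tau>\<bar>)"
        by (simp add: exp_add[symmetric])
      then have "((C / 2)\<^sup>2 * exp (- 2 * (sqrt r - 1) * cos d)) * (exp (\<theta> * \<tau>) * exp (- 2 * d * \<bar>\<tau>\<bar>)) \<le>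
          ((C / 2)\<^sup>2 * exp (- 2 * (sqrt r - 1) * cos d)) * exp ((\<beta> - pi) * \<bar>\<tau>\<bar>)"
        by (intro mult_left_mono) auto
      moreover have "exp (\<theta> * \<tau>) * (norm (Macdonald_K (Complex \<alpha> \<tau>) (sqrt r)))\<^sup>2 \<le>
        ((C / 2)\<^sup>2 * exp (- 2 * (sqrt r - 1) * cos d)) * (exp (\<theta> * \<tau>) * exp (- 2 * d * \<bar>\<tau>\<bar>))"
        using mult_left_mono[OF K, of "exp (\<theta> * \<tau>)"] by (simp add: mult_ac)
      ultimately have "exp (\<theta> * \<tau>) * (norm (Macdonald_K (Complex \<alpha> \<tau>) (sqrt r)))\<^sup>2 \<le>
        ((C / 2)\<^sup>2 * exp (- 2 * (sqrt r - 1) * cos d)) * exp ((\<beta> - pi) * \<bar>\<tau>\<bar>)"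
        by linarith
      from mult_right_mono[OF this norm_ge_zero[of "g \<tau>"]]
      show "norm (Psi_integrand \<alpha> g r \<theta> \<tau>) \<le> ((C / 2)\<^sup>2 * exp (- 2 * (sqrt r - 1) * cos d)) * (norm (g \<tau>) * exp ((\<beta> - pi) * \<bar>\<tau>\<bar>))"
        by (simp add: Psi_integrand_def abs_mult mult_ac)
    qed (use integrable_g in simp)
    then show ?thesis
      by (simp add: G_def)
  qed
  show ?thesis
  proof (rule Lim_null_comparison)
    show "eventually (\<lambda>r. norm (Psi \<alpha> g r \<theta>) \<le> (C / 2)\<^sup>2 * exp (- 2 * (sqrt r - 1) * cos d) * G) at_top"
      using eventually_ge_at_top[of 1] by eventually_elim (rule bound)
    have "((\<lambda>r. exp (- 2 * (sqrt r - 1) * cos d)) \<longlongrightarrow> 0) at_top"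
      using cos by real_asymp
    then show "((\<lambda>r. (C / 2)\<^sup>2 * exp (- 2 * (sqrt r - 1) * cos d) * G) \<longlongrightarrow> 0) at_top"
      by (intro tendsto_mult_left_zero tendsto_mult_right_zero)
  qed
qed

end

theorem theorem6:
  fixes \<alpha> \<beta> :: real and g :: "real \<Rightarrow> complex"
  assumes "0 < \<beta>" and "\<beta> < 2 * pi"
    and "g \<in> weighted_L1 (\<lambda>\<tau>. exp ((\<beta> - pi) * \<bar>\<tau>\<bar>))"
  shows "(\<forall>r>0. \<forall>\<theta>\<in>{0..<\<beta>}. integrable lebesgue (Psi_integrand \<alpha> g r \<theta>))
    \<and> solves_wedge_pde \<alpha> \<beta> (Psi \<alpha> g)
    \<and> (\<forall>\<theta>\<in>{0..<\<beta>}. ((\<lambda>r. Psi \<alpha> g r \<theta>) \<longlongrightarrow> 0) at_top)"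
  using integrable_Psi_integrand[OF assms(3)] Psi_solves_wedge_pde[OF assms(3)] Psi_tendsto_0[OF assms(3)]
  by blast

end
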